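(* Let $\mathcal{T}_0=(A_0B_0C_0D_0)$ be a convex cyclic quadrilateral in the Euclidean plane whose circumcircle is the circle $\mathcal{C}$ of center $O$ and radius $1$, with pairwise distinct vertices, and let $(d_{ij})_{i<j}$ be its squared lengths. Let $(\mathcal{T}_n)_{n\ge 0}$, with centroids $(G_n)_{n\ge 0}$, be the sequence of convex quadrilaterals produced from it by the iteration described in the context. Then the sequences $(\mathcal{T}_{2i})_i$ and $(\mathcal{T}_{2i+1})_i$ are well defined and converge to rectangles that have the same image (the same set of vertices), whose centroid is $O$, and whose squared lengths (sides and diagonals) are given by $$d_{13}^\infty=4,\qquad d_{12}^\infty=4\,\frac{\sqrt{d_{12}d_{34}}}{\sqrt{d_{13}d_{24}}},\qquad d_{14}^\infty=4-d_{12}^\infty .$$ If the limit form is not a square, then $$OG_{n+1}\sim\frac{|d_{12}^\infty-2|}{2}\,OG_n$$ and the sequence converges with at least geometric speed; otherwise (the limit form is a square) the convergence is even faster. Moreover, there are examples where the limit form is a square and the convergence is with order three.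
   Context: $MN$ denotes the Euclidean distance between points $M,N$. Iteration: given $\mathcal{T}_n=(A_nB_nC_nD_n)$ with vertices on $\mathcal{C}$ and centroid $G_n=\frac14(A_n+B_n+C_n+D_n)$, $\mathcal{T}_{n+1}=(A_{n+1}B_{n+1}C_{n+1}D_{n+1})$, where $A_{n+1}$ is the second intersection point of the line $G_nA_n$ with $\mathcal{C}$ (other than $A_n$), and similarly $B_{n+1},C_{n+1},D_{n+1}$ are obtained from the lines $G_nB_n,G_nC_n,G_nD_n$. The vertices $A_0,B_0,C_0,D_0$ are listed in cyclic order, and a quadrilateral is viewed as the ordered quadruple of its vertices. Squared lengths of a quadrilateral $(ABCD)$: $d_{12}=AB^2$, $d_{13}=AC^2$, $d_{14}=AD^2$, $d_{23}=BC^2$, $d_{24}=BD^2$, $d_{34}=CD^2$; the $d_{ij}^\infty$ are those of the limit rectangles (the limit form). For positive sequences, $f_n\sim g_n$ means $\lim_{n\to\infty}f_n/g_n=1$; the relation for $OG_n$ is understood when $OG_n>0$ for all $n$. Convergence to a limit $x$ with at least geometric speed means that the distance of the $n$-th term to $x$ is $O(q^n)$ for some $q\in(0,1)$. Convergence with order three means $OG_{n+1}\sim OG_n^3$. *)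

theory Defs
  imports "HOL-Analysis.Analysis" "HOL-Library.Landau_Symbols"
begin

text \<open>The Euclidean plane is \<^typ>\<open>complex\<close> with its metric; the circle of center
  \<open>c\<close> and radius \<open>1\<close> is \<open>sphere c 1\<close>. A quadrilateral is the ordered quadruple of its vertices,
  and quadruples carry the product metric.\<close>

type_synonym quad = "complex \<times> complex \<times> complex \<times> complex"

text \<open>Vertices are numbered from 1 to 4; other indices are never used.\<close>

fun vertex :: "quad \<Rightarrow> nat \<Rightarrow> complex" where
  "vertex (A, B, C, D) i = [A, B, C, D] ! (i - 1)"

definition vertices :: "quad \<Rightarrow> complex set" where
  "vertices T = vertex T ` {1..4}"

definition centroid :: "quad \<Rightarrow> complex" where
  "centroid T = (\<Sum>i\<in>{1..4}. vertex T i) / 4"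

definition sqlen :: "quad \<Rightarrow> nat \<Rightarrow> nat \<Rightarrow> real" where
  "sqlen T i j = (dist (vertex T i) (vertex T j))\<^sup>2"

text \<open>Each side line leaves the two remaining vertices strictly on one side, that is, the
  line does not meet the opposite side. In particular, the vertices are listed in cyclic order
  (in one of the two orientations).\<close>

fun convex_quadrilateral :: "quad \<Rightarrow> bool" where
  "convex_quadrilateral (A, B, C, D) \<longleftrightarrow>
     affine hull {A, B} \<inter> closed_segment C D = {} \<and>
     affine hull {B, C} \<inter> closed_segment D A = {} \<and>
     affine hull {C, D} \<inter> closed_segment A B = {} \<and>
     affine hull {D, A} \<inter> closed_segment B C = {}"

definition convex_cyclic_quad :: "complex \<Rightarrow> quad \<Rightarrow> bool" where
  "convex_cyclic_quad c T \<longleftrightarrow>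
     vertices T \<subseteq> sphere c 1 \<and> inj_on (vertex T) {1..4} \<and> convex_quadrilateral T"

fun is_rectangle :: "quad \<Rightarrow> bool" where
  "is_rectangle (A, B, C, D) \<longleftrightarrow>
     distinct [A, B, C, D] \<and>
     orthogonal (D - A) (B - A) \<and> orthogonal (A - B) (C - B) \<and>
     orthogonal (B - C) (D - C) \<and> orthogonal (C - D) (A - D)"

definition is_square :: "quad \<Rightarrow> bool" where
  "is_square T \<longleftrightarrow> is_rectangle T \<and> sqlen T 1 2 = sqlen T 1 4"

text \<open>\<open>P\<close> is an intersection point, other than \<open>M\<close>, of the line \<open>GM\<close> with the circle
  (for \<open>G \<noteq> M\<close>, so that \<open>affine hull {G, M}\<close> is a line).\<close>

definition second_intersection :: "complex \<Rightarrow> complex \<Rightarrow> complex \<Rightarrow> complex \<Rightarrow> bool" where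
  "second_intersection c G M P \<longleftrightarrow> P \<in> sphere c 1 \<inter> affine hull {G, M} \<and> P \<noteq> M"

definition next_vertex :: "complex \<Rightarrow> quad \<Rightarrow> nat \<Rightarrow> complex" where
  "next_vertex c T i = (THE P. second_intersection c (centroid T) (vertex T i) P)"

definition next_quad :: "complex \<Rightarrow> quad \<Rightarrow> quad" where
  "next_quad c T = (next_vertex c T 1, next_vertex c T 2, next_vertex c T 3, next_vertex c T 4)"

text \<open>The four lines exist and each has exactly one further intersection point with the circle,
  so that the definite descriptions in \<open>next_quad\<close> are meaningful.\<close>

definition next_quad_well_defined :: "complex \<Rightarrow> quad \<Rightarrow> bool" where
  "next_quad_well_defined c T \<longleftrightarrow>
     (\<forall>i\<in>{1..4}. centroid T \<noteq> vertex T i \<and>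
        (\<exists>!P. second_intersection c (centroid T) (vertex T i) P))"

definition quad_seq :: "complex \<Rightarrow> quad \<Rightarrow> nat \<Rightarrow> quad" where
  "quad_seq c T n = (next_quad c ^^ n) T"

definition OG :: "complex \<Rightarrow> quad \<Rightarrow> nat \<Rightarrow> real" where
  "OG c T n = dist c (centroid (quad_seq c T n))"

definition at_least_geometric :: "(nat \<Rightarrow> 'a::metric_space) \<Rightarrow> 'a \<Rightarrow> bool" where
  "at_least_geometric x l \<longleftrightarrow> (\<exists>q\<in>{0<..<1::real}. (\<lambda>n. dist (x n) l) \<in> O(\<lambda>n. q ^ n))"

definition faster_than_geometric :: "(nat \<Rightarrow> 'a::metric_space) \<Rightarrow> 'a \<Rightarrow> bool" where
  "faster_than_geometric x l \<longleftrightarrow> (\<forall>q\<in>{0<..<1::real}. (\<lambda>n. dist (x n) l) \<in> O(\<lambda>n. q ^ n))"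

end

theory Submission
  imports Defs
begin

text \<open>Put the center of the circle at the origin. If \<open>g\<close> lies inside the unit circle and \<open>a\<close> on it, the
chord through \<open>a\<close> and \<open>g\<close> meets the circle again at \<open>(g - a) / (1 - cnj g * a)\<close>
(\<open>second_intersection_iff\<close>). The second intersection points are therefore the images of the
vertices under a single Moebius involution of the disc, the one that exchanges \<open>0\<close> and \<open>g\<close>. So
one step of the iteration applies such a map to the whole quadrilateral, and all quadrilaterals
of the sequence belong to one orbit of the group of disc automorphisms.

This orbit has a simple normal form. In the disc model of the hyperbolic plane the two diagonals
of a convex cyclic quadrilateral can be replaced by geodesics with the same ends, which cross at
one point; moving that point to \<open>0\<close> turns these geodesics into diameters, hence the quadrilateral
into a rectangle. Thus every convex cyclic quadrilateral has vertices \<open>\<rho> * disc_involution p r\<close>, where \<open>\<rho>\<close> is a unit complex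
number, \<open>p\<close> a point of the open disc, and \<open>r\<close> runs through a rectangle \<open>u, cnj u, - u, - cnj u\<close>
inscribed in the unit circle (\<open>convex_cyclic_quad_moebius_rectangle\<close>). The rectangle stays the
same during the iteration, and the absolute cross-ratio of the vertices determines its side
lengths; this gives the formula for the limit lengths.

With \<open>k = Re (u\<^sup>2)\<close>, the iteration becomes a map of the parameter \<open>p\<close> alone, which can be
computed in closed form (\<open>centroid_moebius_rectangle\<close>, \<open>next_quad_moebius_rectangle\<close>):
\<open>p' = q * (k - q\<^sup>2) / (1 - k * q\<^sup>2)\<close> with \<open>q = cnj p\<close>.
The factor of \<open>q\<close> is again a disc automorphism applied to \<open>q\<^sup>2\<close>. On every smaller concentric
disc its norm is bounded by a constant below \<open>1\<close>, so the parameter tends to \<open>0\<close> geometrically from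
every starting point. Near \<open>0\<close> the factor is close to \<open>k\<close>, whose absolute value is the
claimed rate. In the square case
\<open>k = 0\<close> the map is exactly \<open>p' = - (cnj p) ^ 3\<close>, so the convergence is cubic whenever \<open>p \<noteq> 0\<close>.

Finally, for \<open>p\<close> near \<open>0\<close> one step is nearly the half turn \<open>z \<mapsto> - z\<close>, so the rotation
\<open>\<rho>\<close> is multiplied by almost \<open>- 1\<close> in each step. The errors of these factors are summable,
which is why the terms of even and of odd index converge separately, to rectangles that differ by a half turn and so have the same vertices.\<close>

section \<open>Moebius involutions of the unit disc\<close>

text \<open>For \<open>p\<close> in the open unit disc this is the automorphism of the disc that exchanges \<open>0\<close> and \<open>p\<close>.\<close>

definition disc_involution :: "complex \<Rightarrow> complex \<Rightarrow> complex" where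
  "disc_involution p z = (p - z) / (1 - cnj p * z)"

lemma disc_involution_denominator_nonzero:
  assumes "norm p < 1" "norm z \<le> 1"
  shows "1 - cnj p * z \<noteq> 0"
proof
  assume "1 - cnj p * z = 0"
  then have "norm (cnj p * z) = 1"
    by simp
  moreover have "norm (cnj p * z) \<le> norm p * 1"
    unfolding norm_mult complex_mod_cnj using assms by (intro mult_left_mono) auto
  ultimately show False
    using assms by simp
qed

lemma norm_eq_1_iff_cnj: "norm z = 1 \<longleftrightarrow> z * cnj z = 1"
  by (metis complex_norm_square norm_ge_zero of_real_1 of_real_eq_iff one_power2 power2_eq_iff_nonneg zero_le_one)

lemma disc_involution_norm_identity:
  "(norm (1 - cnj p * z))\<^sup>2 - (norm (p - z))\<^sup>2 = (1 - (norm p)\<^sup>2) * (1 - (norm z)\<^sup>2)"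
  unfolding cmod_power2 by (simp add: power2_eq_square algebra_simps)

text \<open>The deviation from \<open>1\<close> is explicit: this yields at once that the circle and the open disc
are preserved, and later a bound away from \<open>1\<close> that is uniform on smaller discs.\<close>

lemma norm_disc_involution_sq:
  assumes "norm p < 1" "norm z \<le> 1"
  shows "(norm (disc_involution p z))\<^sup>2
    = 1 - (1 - (norm p)\<^sup>2) * (1 - (norm z)\<^sup>2) / (norm (1 - cnj p * z))\<^sup>2"
  using disc_involution_norm_identity[of p z] disc_involution_denominator_nonzero[OF assms]
  by (simp add: disc_involution_def norm_divide power_divide field_simps)

lemma disc_involution_sphere:
  assumes "norm p < 1" "norm z = 1"
  shows "norm (disc_involution p z) = 1"
  using norm_disc_involution_sq[of p z] assms by (simp add: power2_eq_1_iff)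
    (smt (verit) norm_ge_zero)

lemma disc_involution_disc:
  assumes "norm p < 1" "norm z < 1"
  shows "norm (disc_involution p z) < 1"
proof -
  have "1 - (norm p)\<^sup>2 > 0" "1 - (norm z)\<^sup>2 > 0"
    using assms by (simp_all add: power_less_one_iff abs_square_less_1)
  then have "(norm (disc_involution p z))\<^sup>2 < 1"
    using norm_disc_involution_sq[of p z] disc_involution_denominator_nonzero[of p z] assms
    by simp
  then show ?thesis
    by (simp add: abs_square_less_1)
qed

lemma one_minus_norm_sq: "complex_of_real (1 - (norm p)\<^sup>2) = 1 - p * cnj p"
  by (simp only: of_real_diff of_real_1 complex_norm_square)

lemma one_minus_norm_sq_nonzero:
  assumes "norm p < 1" shows "1 - p * cnj p \<noteq> 0"
  using disc_involution_denominator_nonzero[of p p] assms by (simp add: mult.commute)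

lemma disc_involution_idem:
  assumes "norm p < 1" "norm z \<le> 1"
  shows "disc_involution p (disc_involution p z) = z"
proof -
  have nz: "1 - cnj p * z \<noteq> 0" and nz': "1 - p * cnj p \<noteq> 0"
    using assms disc_involution_denominator_nonzero one_minus_norm_sq_nonzero by auto
  have "p - (p - z) / (1 - cnj p * z) = z * (1 - p * cnj p) / (1 - cnj p * z)"
    using nz by (simp add: field_simps)
  moreover have "1 - cnj p * ((p - z) / (1 - cnj p * z)) = (1 - p * cnj p) / (1 - cnj p * z)"
    using nz by (simp add: field_simps)
  ultimately show ?thesis
    using nz nz' by (simp add: disc_involution_def)
qed

text \<open>Equivariance under rotations allows the rotation of a quadrilateral to be split off from its
parameter.\<close>

lemma disc_involution_rotate:
  assumes "norm \<rho> = 1"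
  shows "disc_involution (\<rho> * p) (\<rho> * z) = \<rho> * disc_involution p z"
proof -
  have "cnj (\<rho> * p) * (\<rho> * z) = (\<rho> * cnj \<rho>) * (cnj p * z)"
    by (simp add: mult_ac)
  also have "\<dots> = cnj p * z"
    using assms norm_eq_1_iff_cnj[of \<rho>] by simp
  finally show ?thesis
    by (simp add: disc_involution_def right_diff_distrib)
qed

lemma disc_involution_diff:
  assumes "norm p < 1" "norm a \<le> 1" "norm b \<le> 1"
  shows "disc_involution p a - disc_involution p b
    = (b - a) * (1 - p * cnj p) / ((1 - cnj p * a) * (1 - cnj p * b))"
  using disc_involution_denominator_nonzero[of p a] disc_involution_denominator_nonzero[of p b] assms
  by (simp add: disc_involution_def divide_simps) (simp add: algebra_simps)

text \<open>Both sides map \<open>q\<close> to \<open>0\<close>, so they can differ only by a rotation. Writing the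
first parameter as \<open>disc_involution p q\<close> makes \<open>q\<close> the parameter of the composition, so that
one step of the iteration will replace \<open>p\<close> by \<open>q\<close>.\<close>

lemma disc_involution_compose:
  assumes p: "norm p < 1" and q: "norm q < 1" and z: "norm z \<le> 1"
  shows "disc_involution (disc_involution p q) (disc_involution p z)
    = - (1 - p * cnj q) / (1 - cnj p * q) * disc_involution q z"
proof -
  have nz: "1 - cnj p * q \<noteq> 0" "1 - cnj p * z \<noteq> 0" "1 - p * cnj p \<noteq> 0" "1 - cnj q * z \<noteq> 0"
    using p q z disc_involution_denominator_nonzero one_minus_norm_sq_nonzero by auto
  have nz': "1 - p * cnj q \<noteq> 0"
    using p q disc_involution_denominator_nonzero[of q p] by (simp add: mult.commute)
  have num: "disc_involution p q - disc_involution p z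
      = (z - q) * (1 - p * cnj p) / ((1 - cnj p * q) * (1 - cnj p * z))"
    using disc_involution_diff[of p q z] p q z by simp
  have den: "1 - cnj (disc_involution p q) * disc_involution p z
      = (1 - cnj q * z) * (1 - p * cnj p) / ((1 - p * cnj q) * (1 - cnj p * z))"
    unfolding disc_involution_def using nz nz'
    by (simp add: divide_simps) (simp add: algebra_simps)
  show ?thesis
    unfolding disc_involution_def[of "disc_involution p q"] num den disc_involution_def[of q z]
    using nz nz' by (simp add: divide_simps) (simp add: algebra_simps)
qed

section \<open>The second intersection of a chord through an interior point\<close>

text \<open>On the line \<open>a + t * (h - a)\<close> the equation of the circle is quadratic in \<open>t\<close> with root \<open>0\<close>, which
belongs to \<open>a\<close>. The other root is nonzero, since a line through an interior point is not tangent.\<close>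

lemma second_intersection_iff:
  assumes m: "norm (M - c) = 1" and g: "norm (G - c) < 1"
  shows "second_intersection c G M P \<longleftrightarrow> P = c + disc_involution (G - c) (M - c)"
proof -
  define a where "a = M - c"
  define h where "h = G - c"
  have a: "a * cnj a = 1" and h: "norm h < 1" and na: "norm a = 1"
    using m g norm_eq_1_iff_cnj by (auto simp: a_def h_def)
  have ah: "a \<noteq> h" using h na by auto
  define s where "s = 2 * Re (cnj a * (a - h)) / (norm (a - h))\<^sup>2"
  have n2: "(norm (a - h))\<^sup>2 \<noteq> 0" using ah by simp
  have quad: "(norm (a + t * (h - a)))\<^sup>2 = 1 + t * (t * (norm (a - h))\<^sup>2 - 2 * Re (cnj a * (a - h)))" for t :: real
  proof -
    have "(norm (a + t * (h - a)))\<^sup>2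
        = (norm a)\<^sup>2 + t * (t * (norm (a - h))\<^sup>2 - 2 * Re (cnj a * (a - h)))"
      unfolding cmod_power2 by (simp add: power2_eq_square algebra_simps)
    then show ?thesis
      using na by simp
  qed
  have "Re (cnj a * (a - h)) = 1 - Re (cnj a * h)"
    using a by (simp add: right_diff_distrib mult.commute)
  moreover have "Re (cnj a * h) \<le> norm (cnj a * h)" by (rule complex_Re_le_cmod)
  ultimately have "Re (cnj a * (a - h)) > 0"
    using h na by (simp add: norm_mult)
  then have s: "s \<noteq> 0" using n2 by (simp add: s_def)
  have dist_shift: "dist c (c + z) = norm z" for z
    by (simp add: dist_norm)
  have sphere: "c + (a + t * (h - a)) \<in> sphere c 1 \<longleftrightarrow> t = 0 \<or> t = s" for t :: real
  proof -
    have "c + (a + t * (h - a)) \<in> sphere c 1 \<longleftrightarrow> (norm (a + t * (h - a)))\<^sup>2 = 1"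
      using abs_square_eq_1[of "norm (a + t * (h - a))"]
      by (simp only: mem_sphere dist_shift abs_norm_cancel)
    also have "\<dots> \<longleftrightarrow> t = 0 \<or> t * (norm (a - h))\<^sup>2 = 2 * Re (cnj a * (a - h))"
      unfolding quad by auto
    also have "\<dots> \<longleftrightarrow> t = 0 \<or> t = s"
      using n2 by (simp add: s_def eq_divide_eq)
    finally show ?thesis .
  qed
  have hull: "affine hull {G, M} = {c + (a + t * (h - a)) |t::real. True}"
    unfolding insert_commute[of G M "{}"] affine_hull_2_alt
    by (auto simp: a_def h_def scaleR_conv_of_real algebra_simps)
  have "second_intersection c G M P \<longleftrightarrow> P = c + (a + s * (h - a))"
  proof
    assume "second_intersection c G M P"
    then have P: "P \<in> sphere c 1" "P \<noteq> M" "P \<in> affine hull {G, M}"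
      by (auto simp: second_intersection_def)
    then obtain t where t: "P = c + (a + of_real t * (h - a))" using hull by auto
    with P sphere[of t] have "t = 0 \<or> t = s" by simp
    moreover have "t \<noteq> 0" using t P by (auto simp: a_def)
    ultimately show "P = c + (a + s * (h - a))" using t by simp
  next
    assume P: "P = c + (a + s * (h - a))"
    have "P \<in> sphere c 1" unfolding P using sphere[of s] by blast
    moreover have "P \<in> affine hull {G, M}" unfolding hull P by blast
    moreover have "P \<noteq> M"
    proof
      assume "P = M"
      then have "of_real s * (h - a) = 0" unfolding P by (simp add: a_def)
      then show False using s ah by simp
    qed
    ultimately show "second_intersection c G M P" by (simp add: second_intersection_def)
  qed
  moreover have "a + s * (h - a) = disc_involution h a"
  proof -
    have na0: "a \<noteq> 0" "a - h \<noteq> 0" "cnj a - cnj h \<noteq> 0" using na ah by auto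
    have s': "of_real s = (cnj a * (a - h) + a * (cnj a - cnj h)) / ((a - h) * (cnj a - cnj h))"
    proof -
      have "of_real (2 * Re (cnj a * (a - h))) = cnj a * (a - h) + a * (cnj a - cnj h)"
        using complex_add_cnj[of "cnj a * (a - h)"] by simp
      moreover have "of_real ((norm (a - h))\<^sup>2) = (a - h) * (cnj a - cnj h)"
        by (simp only: complex_norm_square complex_cnj_diff)
      ultimately show ?thesis unfolding s_def of_real_divide by simp
    qed
    have "1 - cnj h * a = a * (cnj a - cnj h)" using a by (simp add: algebra_simps)
    then have d: "disc_involution h a = (h - a) / (a * (cnj a - cnj h))"
      by (simp add: disc_involution_def)
    have "a + s * (h - a) = - (cnj a * (a - h)) / (cnj a - cnj h)"
      unfolding s' using na0 by (simp add: divide_simps) (simp add: algebra_simps)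
    also have "\<dots> = disc_involution h a"
      unfolding d using na0 a by (simp add: divide_simps) (simp add: algebra_simps)
    finally show ?thesis .
  qed
  ultimately have "second_intersection c G M P \<longleftrightarrow> P = c + disc_involution h a"
    by simp
  then show ?thesis by (simp only: a_def h_def)
qed

section \<open>Orientation and convexity\<close>

text \<open>Twice the usual signed area of the triangle; only its sign and its scaling under maps matter.\<close>

definition signed_area :: "complex \<Rightarrow> complex \<Rightarrow> complex \<Rightarrow> real" where
  "signed_area A B C = Im (cnj (B - A) * (C - A))"

lemma affine_hull_2_iff_signed_area:
  assumes "A \<noteq> B"
  shows "X \<in> affine hull {A, B} \<longleftrightarrow> signed_area A B X = 0"
proof
  assume "X \<in> affine hull {A, B}"
  then obtain t :: real where "X = A + t *\<^sub>R (B - A)"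
    unfolding affine_hull_2_alt by auto
  then have "cnj (B - A) * (X - A) = of_real t * (cnj (B - A) * (B - A))"
    by (simp add: scaleR_conv_of_real)
  also have "cnj (B - A) * (B - A) = of_real ((norm (B - A))\<^sup>2)"
    by (simp only: complex_norm_square mult.commute)
  also have "Im (of_real t * \<dots>) = 0"
    by simp
  finally show "signed_area A B X = 0"
    by (simp only: signed_area_def)
next
  assume area: "signed_area A B X = 0"
  define t where "t = Re (cnj (B - A) * (X - A)) / (norm (B - A))\<^sup>2"
  have "cnj (B - A) * (X - A) = of_real (Re (cnj (B - A) * (X - A)))"
    using area unfolding signed_area_def by (intro complex_eqI) auto
  also have "\<dots> = of_real (t * (norm (B - A))\<^sup>2)"
    using assms by (simp add: t_def)
  also have "\<dots> = cnj (B - A) * (of_real t * (B - A))"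
    unfolding of_real_mult complex_norm_square by (simp add: mult_ac)
  finally have "X - A = of_real t * (B - A)"
    using assms by simp
  then have "X = A + t *\<^sub>R (B - A)"
    by (simp add: scaleR_conv_of_real algebra_simps)
  then show "X \<in> affine hull {A, B}"
    unfolding affine_hull_2_alt by blast
qed

lemma signed_area_affine:
  "signed_area A B ((1 - t) *\<^sub>R C + t *\<^sub>R D)
    = (1 - t) * signed_area A B C + t * signed_area A B D"
  by (simp add: signed_area_def algebra_simps)

text \<open>The signed area is affine in its third argument, so along a segment it takes the value zero, which
characterizes the points of the line, unless both ends have the same strict sign.\<close>

lemma line_misses_segment_iff:
  assumes "A \<noteq> B"
  shows "affine hull {A, B} \<inter> closed_segment C D = {}
    \<longleftrightarrow> signed_area A B C * signed_area A B D > 0"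
proof
  let ?s = "signed_area A B"
  assume empty: "affine hull {A, B} \<inter> closed_segment C D = {}"
  show "?s C * ?s D > 0"
  proof (rule ccontr)
    assume "\<not> ?s C * ?s D > 0"
    then have opp: "?s C * ?s D \<le> 0" by simp
    show False
    proof (cases "?s C = ?s D")
      case True
      then have "?s C = 0" using opp by (auto simp: mult_le_0_iff)
      then have "C \<in> affine hull {A, B}" using affine_hull_2_iff_signed_area[OF assms] by blast
      then show False using empty by auto
    next
      case False
      define t where "t = ?s C / (?s C - ?s D)"
      have "0 \<le> t" "t \<le> 1"
        using opp False by (auto simp: t_def mult_le_0_iff divide_simps)
      moreover have "?s ((1 - t) *\<^sub>R C + t *\<^sub>R D) = 0"
        unfolding signed_area_affine using False by (simp add: t_def field_simps)
      ultimately have "(1 - t) *\<^sub>R C + t *\<^sub>R D \<in> affine hull {A, B} \<inter> closed_segment C D"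
        using affine_hull_2_iff_signed_area[OF assms] by (auto simp: closed_segment_def)
      then show False using empty by blast
    qed
  qed
next
  let ?s = "signed_area A B"
  assume same: "?s C * ?s D > 0"
  show "affine hull {A, B} \<inter> closed_segment C D = {}"
  proof (rule ccontr)
    assume "affine hull {A, B} \<inter> closed_segment C D \<noteq> {}"
    then obtain t where t: "0 \<le> t" "t \<le> 1" "?s ((1 - t) *\<^sub>R C + t *\<^sub>R D) = 0"
      using affine_hull_2_iff_signed_area[OF assms] by (auto simp: closed_segment_def)
    then have eq: "(1 - t) * ?s C + t * ?s D = 0" by (simp add: signed_area_affine)
    have "(1 - t) * (?s C * ?s C) + t * (?s C * ?s D) = 0"
      using arg_cong[OF eq, of "\<lambda>x. ?s C * x"] by (simp add: algebra_simps)
    moreover have "?s C * ?s C > 0" using same by (auto simp: zero_less_mult_iff)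
    ultimately show False using same t
      by (metis add_nonneg_eq_0_iff diff_ge_0_iff_ge less_eq_real_def less_irrefl
          mult_eq_0_iff mult_nonneg_nonneg right_minus_eq zero_neq_one)
  qed
qed

lemma signed_area_translate: "signed_area (c + A) (c + B) (c + C) = signed_area A B C"
  by (simp add: signed_area_def)

lemma signed_area_rotate:
  assumes "norm \<rho> = 1"
  shows "signed_area (\<rho> * A) (\<rho> * B) (\<rho> * C) = signed_area A B C"
proof -
  have "cnj (\<rho> * B - \<rho> * A) * (\<rho> * C - \<rho> * A) = (\<rho> * cnj \<rho>) * (cnj (B - A) * (C - A))"
    by (simp add: algebra_simps)
  then show ?thesis
    using assms norm_eq_1_iff_cnj[of \<rho>] by (simp add: signed_area_def)
qed

lemma vertices_eq: "vertices (A, B, C, D) = {A, B, C, D}"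
proof -
  have "{1..4} = {1, 2, 3, 4::nat}" by auto
  then show ?thesis by (simp add: vertices_def)
qed

lemma inj_on_vertex_iff: "inj_on (vertex (A, B, C, D)) {1..4} \<longleftrightarrow> distinct [A, B, C, D]"
proof -
  have "{1..4} = {1, 2, 3, 4::nat}" by auto
  then show ?thesis by (auto simp: inj_on_def)
qed

lemma centroid_eq: "centroid (A, B, C, D) = (A + B + C + D) / 4"
proof -
  have "{1..4} = {1, 2, 3, 4::nat}" by auto
  then show ?thesis by (simp add: centroid_def add_ac)
qed

text \<open>Convexity in cyclic order means that all four triangles of vertices have the same orientation.\<close>

lemma convex_cyclic_quad_iff:
  "convex_cyclic_quad c (A, B, C, D) \<longleftrightarrow>
    {A, B, C, D} \<subseteq> sphere c 1 \<and> distinct [A, B, C, D] \<and>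
    signed_area A B C * signed_area A B D > 0 \<and> signed_area B C D * signed_area A B C > 0 \<and>
    signed_area C D A * signed_area B C D > 0 \<and> signed_area A B D * signed_area C D A > 0"
proof (cases "distinct [A, B, C, D]")
  case True
  then have "A \<noteq> B" "B \<noteq> C" "C \<noteq> D" "D \<noteq> A" by auto
  moreover have "signed_area B C A = signed_area A B C" "signed_area C D B = signed_area B C D"
    "signed_area D A B = signed_area A B D" "signed_area D A C = signed_area C D A"
    by (simp_all add: signed_area_def algebra_simps)
  ultimately show ?thesis
    using True
    unfolding convex_cyclic_quad_def vertices_eq inj_on_vertex_iff
    by (simp add: line_misses_segment_iff)
next
  case False
  then show ?thesis
    unfolding convex_cyclic_quad_def inj_on_vertex_iff by blast
qed

text \<open>On the unit circle conjugation is inversion, which turns the signed area into a product of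
differences. This form transforms well under Moebius maps.\<close>

lemma signed_area_complex:
  assumes "norm a = 1" "norm b = 1" "norm c = 1"
  shows "2 * \<i> * of_real (signed_area a b c) = (c - a) * (a - b) * (c - b) / (a * b * c)"
proof -
  have nz: "a \<noteq> 0" "b \<noteq> 0" "c \<noteq> 0" using assms by auto
  have cnj: "cnj a = 1 / a" "cnj b = 1 / b" "cnj c = 1 / c"
    using assms nz norm_eq_1_iff_cnj by (auto simp: field_simps)
  define w where "w = cnj (b - a) * (c - a)"
  have "2 * \<i> * of_real (Im w) = w - cnj w"
    by (intro complex_eqI) auto
  also have "\<dots> = (cnj b - cnj a) * (c - a) - (b - a) * (cnj c - cnj a)"
    by (simp add: w_def)
  also have "\<dots> = (c - a) * (a - b) * (c - b) / (a * b * c)"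
    unfolding cnj using nz
    by (simp add: divide_simps) (simp add: algebra_simps)
  finally show ?thesis by (simp add: w_def signed_area_def)
qed

text \<open>Disc automorphisms preserve the cyclic order on the circle. The factor is obtained from the product formula:
each difference and each vertex contributes powers of \<open>1 - cnj p * z\<close>, and on the circle these
combine to squared absolute values.\<close>

lemma disc_involution_orientation:
  assumes p: "norm p < 1" and abc: "norm a = 1" "norm b = 1" "norm c = 1"
  obtains t where "t > 0"
    "signed_area (disc_involution p a) (disc_involution p b) (disc_involution p c)
      = t * signed_area a b c"
proof -
  let ?D = "disc_involution p"
  define d where "d z = 1 - cnj p * z" for z
  define k where "k = (1 - (norm p)\<^sup>2) ^ 3"
  define t where "t = k / ((norm (d a))\<^sup>2 * (norm (d b))\<^sup>2 * (norm (d c))\<^sup>2)"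
  have d: "d a \<noteq> 0" "d b \<noteq> 0" "d c \<noteq> 0"
    using disc_involution_denominator_nonzero[OF p] abc by (auto simp: d_def)
  have nz: "a \<noteq> 0" "b \<noteq> 0" "c \<noteq> 0" using abc by auto
  have "k > 0" using p by (simp add: k_def abs_square_less_1)
  then have t: "t > 0" using d by (simp add: t_def)
  \<comment> \<open>On the circle the squared norm of the denominator is rational in the point and its image.\<close>
  have sq: "of_real ((norm (d z))\<^sup>2) = - d z * d z * ?D z / z" and D: "?D z \<noteq> 0"
    if z: "norm z = 1" for z
  proof -
    have zz: "z * cnj z = 1" using z norm_eq_1_iff_cnj by blast
    have dz: "d z \<noteq> 0"
      using disc_involution_denominator_nonzero[OF p] z by (auto simp: d_def)
    have "of_real ((norm (d z))\<^sup>2) = d z * (1 - p * cnj z)"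
      by (simp only: complex_norm_square d_def) simp
    also have "1 - p * cnj z = (z - p) / z"
    proof -
      have "z \<noteq> 0" using z by auto
      then show ?thesis using zz by (simp add: field_simps)
    qed
    also have "(z - p) = - (d z * ?D z)"
      using dz by (simp add: disc_involution_def flip: d_def)
    finally show "of_real ((norm (d z))\<^sup>2) = - d z * d z * ?D z / z" by (simp add: mult_ac)
    show "?D z \<noteq> 0" using disc_involution_sphere[OF p z] by auto
  qed
  have diff: "?D x - ?D y = (y - x) * (1 - p * cnj p) / (d x * d y)"
    if "norm x = 1" "norm y = 1" for x y
    using disc_involution_diff[OF p] that by (simp add: d_def)
  have "2 * \<i> * of_real (signed_area (?D a) (?D b) (?D c))
      = (?D c - ?D a) * (?D a - ?D b) * (?D c - ?D b) / (?D a * ?D b * ?D c)"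
    using signed_area_complex disc_involution_sphere[OF p] abc by blast
  also have "\<dots> = - ((1 - p * cnj p) ^ 3) * ((c - a) * (a - b) * (c - b))
      / ((d a * d a * ?D a) * (d b * d b * ?D b) * (d c * d c * ?D c))"
    unfolding diff[OF abc(3,1)] diff[OF abc(1,2)] diff[OF abc(3,2)] power3_eq_cube
    using d D[OF abc(1)] D[OF abc(2)] D[OF abc(3)]
    by (simp add: divide_simps) algebra
  also have "\<dots> = of_real t * ((c - a) * (a - b) * (c - b) / (a * b * c))"
    unfolding t_def k_def of_real_divide of_real_mult of_real_power[of _ 3] one_minus_norm_sq
      sq[OF abc(1)] sq[OF abc(2)] sq[OF abc(3)]
    using nz d D abc by (simp add: divide_simps)
  also have "\<dots> = 2 * \<i> * of_real (t * signed_area a b c)"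
    unfolding signed_area_complex[OF abc, symmetric] by simp
  finally have "signed_area (?D a) (?D b) (?D c) = t * signed_area a b c"
    by (simp only: mult_cancel_left of_real_eq_iff) auto
  with t show thesis by (rule that)
qed

section \<open>Cyclic quadrilaterals as moved rectangles\<close>

text \<open>A rectangle inscribed in the circle, moved by the disc automorphism with parameter \<open>p\<close> and
then rotated by \<open>\<rho>\<close>. Up to rotation an inscribed rectangle has the symmetric form
\<open>u, cnj u, - u, - cnj u\<close>; it is nondegenerate when \<open>Re u\<close> and \<open>Im u\<close> do not vanish.\<close>

definition moebius_rectangle :: "complex \<Rightarrow> complex \<Rightarrow> complex \<Rightarrow> complex \<Rightarrow> quad" where
  "moebius_rectangle c \<rho> p u =
    (c + \<rho> * disc_involution p u, c + \<rho> * disc_involution p (cnj u),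
     c + \<rho> * disc_involution p (- u), c + \<rho> * disc_involution p (- cnj u))"

text \<open>The four triangles of the rectangle have the same signed area, and the motion preserves orientations.\<close>

lemma moebius_rectangle_convex_cyclic:
  assumes \<rho>: "norm \<rho> = 1" and p: "norm p < 1" and u: "norm u = 1" "Re u \<noteq> 0" "Im u \<noteq> 0"
  shows "convex_cyclic_quad c (moebius_rectangle c \<rho> p u)"
proof -
  define V where "V z = c + \<rho> * disc_involution p z" for z
  define s where "s = - 4 * Re u * Im u"
  have s: "s \<noteq> 0" using u by (simp add: s_def)
  have area: "\<exists>t>0. signed_area (V x) (V y) (V z) = t * signed_area x y z"
    if "norm x = 1" "norm y = 1" "norm z = 1" for x y z
    using disc_involution_orientation[OF p that] unfolding V_def signed_area_translate signed_area_rotate[OF \<rho>]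
    by metis
  let ?A = "V u" and ?B = "V (cnj u)" and ?C = "V (- u)" and ?D = "V (- cnj u)"
  have "signed_area u (cnj u) (- u) = s" "signed_area u (cnj u) (- cnj u) = s"
    "signed_area (cnj u) (- u) (- cnj u) = s" "signed_area (- u) (- cnj u) u = s"
    by (simp_all add: signed_area_def s_def algebra_simps)
  then obtain t1 t2 t3 t4 where t: "t1 > 0" "t2 > 0" "t3 > 0" "t4 > 0"
    and areas: "signed_area ?A ?B ?C = t1 * s" "signed_area ?A ?B ?D = t2 * s"
      "signed_area ?B ?C ?D = t3 * s" "signed_area ?C ?D ?A = t4 * s"
    using area[of u "cnj u" "- u"] area[of u "cnj u" "- cnj u"]
      area[of "cnj u" "- u" "- cnj u"] area[of "- u" "- cnj u" u] u by auto
  have ss: "s * s > 0" using s not_real_square_gt_zero by blast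
  have prods: "x * s * (y * s) > 0" if "x > 0" "y > 0" for x y
    using mult_pos_pos[OF mult_pos_pos[OF that] ss] by (simp add: mult_ac)
  have degenerate: "signed_area x x y = 0" "signed_area x y x = 0" "signed_area y x x = 0" for x y
    by (simp_all add: signed_area_def algebra_simps)
  have "signed_area ?A ?B ?C \<noteq> 0" "signed_area ?A ?B ?D \<noteq> 0" "signed_area ?B ?C ?D \<noteq> 0"
    using t s by (simp_all add: areas)
  then have "distinct [?A, ?B, ?C, ?D]"
    using degenerate by fastforce
  moreover have "{?A, ?B, ?C, ?D} \<subseteq> sphere c 1"
    using u by (simp add: V_def dist_norm norm_mult \<rho> disc_involution_sphere[OF p])
  ultimately show ?thesis
    unfolding moebius_rectangle_def V_def[symmetric] convex_cyclic_quad_iff areas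
    using prods t by auto
qed

text \<open>The equation of a chord of the unit circle in complex coordinates.\<close>

lemma chord_equation:
  assumes a: "norm a = 1" and b: "norm b = 1" and X: "X = a + of_real t * (b - a)"
  shows "X + a * b * cnj X = a + b"
proof -
  have "a * cnj a = 1" "b * cnj b = 1" using a b norm_eq_1_iff_cnj by auto
  moreover have "a * b * cnj X = (a * cnj a) * b + of_real t * (a * (b * cnj b) - (a * cnj a) * b)"
    unfolding X by (simp add: algebra_simps)
  ultimately have "a * b * cnj X = b + of_real t * (a - b)"
    by simp
  then show ?thesis by (simp add: X algebra_simps)
qed

text \<open>The points \<open>X\<close> and \<open>p\<close> represent the same point of the hyperbolic plane, \<open>X\<close> in the Klein model, where
geodesics are chords, and \<open>p\<close> in the conformal disc model. If the point lies on the geodesic from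
\<open>a\<close> to \<open>b\<close>, moving it to \<open>0\<close> makes this geodesic a diameter.\<close>

lemma disc_involution_antipodal:
  assumes p: "norm p < 1" and X: "X * (1 + p * cnj p) = 2 * p"
    and a: "norm a = 1" and b: "norm b = 1" and chord: "X + a * b * cnj X = a + b"
  shows "disc_involution p b = - disc_involution p a"
proof -
  have nz: "1 - cnj p * a \<noteq> 0" "1 - cnj p * b \<noteq> 0"
    using disc_involution_denominator_nonzero[OF p] a b by auto
  have X': "cnj X * (1 + p * cnj p) = 2 * cnj p"
    using arg_cong[OF X, of cnj] by (simp add: mult_ac)
  have "(1 + p * cnj p) * (a + b) = X * (1 + p * cnj p) + a * b * (cnj X * (1 + p * cnj p))"
    unfolding chord[symmetric] by (simp add: algebra_simps)
  also have "\<dots> = 2 * p + 2 * a * b * cnj p"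
    unfolding X X' by simp
  finally have "(p - a) * (1 - cnj p * b) + (p - b) * (1 - cnj p * a) = 0"
    by (simp add: algebra_simps)
  then have "disc_involution p a + disc_involution p b = 0"
    using nz by (simp add: disc_involution_def divide_simps)
  then show ?thesis by (simp add: add_eq_0_iff)
qed

text \<open>Conversion from the Klein model to the conformal disc model.\<close>

lemma hyperbolic_point_of_klein_point:
  assumes "norm X < 1"
  obtains p where "norm p < 1" "X * (1 + p * cnj p) = 2 * p"
proof -
  define s where "s = sqrt (1 - (norm X)\<^sup>2)"
  define p where "p = X / of_real (1 + s)"
  have "(norm X)\<^sup>2 < 1"
    using assms by (simp add: abs_square_less_1)
  then have s: "s > 0" "s\<^sup>2 = 1 - (norm X)\<^sup>2"
    by (simp_all add: s_def)
  have np: "norm p = norm X / (1 + s)"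
    unfolding p_def norm_divide norm_of_real using s by simp
  have "norm p < 1"
    unfolding np using assms s by simp
  moreover have "X * (1 + p * cnj p) = 2 * p"
  proof -
    have "X * cnj X = of_real (1 - s\<^sup>2)"
      using s by (simp only: complex_norm_square[symmetric]) simp
    then have "p * cnj p = of_real (1 - s\<^sup>2) / (of_real (1 + s) * of_real (1 + s))"
      unfolding p_def by simp
    also have "\<dots> = of_real ((1 - s) / (1 + s))"
    proof -
      have "1 - s\<^sup>2 = (1 - s) * (1 + s)" by (simp add: power2_eq_square algebra_simps)
      then have "(1 - s\<^sup>2) / ((1 + s) * (1 + s)) = (1 - s) / (1 + s)" using s(1) by simp
      then show ?thesis by (simp only: of_real_mult[symmetric] of_real_divide[symmetric])
    qed
    finally have "1 + p * cnj p = of_real (1 + (1 - s) / (1 + s))"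
      by simp
    also have "1 + (1 - s) / (1 + s) = 2 / (1 + s)"
      using s by (simp add: field_simps)
    finally show ?thesis
      by (simp add: p_def)
  qed
  ultimately show thesis by (rule that)
qed

text \<open>Moving the crossing point of the diagonals to the center makes both diagonals diameters.\<close>

lemma convex_cyclic_quad_moebius_rectangle:
  assumes "convex_cyclic_quad c T"
  obtains \<rho> p u where "norm \<rho> = 1" "norm p < 1" "norm u = 1" "Re u \<noteq> 0" "Im u \<noteq> 0"
    "T = moebius_rectangle c \<rho> p u"
proof -
  obtain A B C D where T: "T = (c + A, c + B, c + C, c + D)"
    by (cases T) (metis add.commute diff_add_cancel)
  have circle: "norm A = 1" "norm B = 1" "norm C = 1" "norm D = 1"
    and dist: "distinct [A, B, C, D]"
    and area: "signed_area A B C * signed_area A B D > 0" "signed_area B C D * signed_area A B C > 0"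
      "signed_area C D A * signed_area B C D > 0" "signed_area A B D * signed_area C D A > 0"
    using assms unfolding T convex_cyclic_quad_iff signed_area_translate
    by (simp_all add: dist_norm)
  \<comment> \<open>Convexity puts \<open>B\<close> and \<open>D\<close> strictly on different sides of the line \<open>AC\<close>; \<open>X\<close> is the point
    where the diagonals cross.\<close>
  define sB where "sB = signed_area A C B"
  define sD where "sD = signed_area A C D"
  have "sB = - signed_area A B C" "sD = signed_area C D A"
    by (simp_all add: sB_def sD_def signed_area_def algebra_simps)
  then have opp: "sB * sD < 0"
    using area by (auto simp: zero_less_mult_iff mult_less_0_iff)
  then have ne: "sB \<noteq> sD" by auto
  define t where "t = sB / (sB - sD)"
  have t: "0 < t" "t < 1"
    using opp by (auto simp: t_def mult_less_0_iff divide_simps)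
  define X where "X = B + of_real t * (D - B)"
  have X': "X = (1 - t) *\<^sub>R B + t *\<^sub>R D"
    by (simp add: X_def scaleR_conv_of_real algebra_simps)
  have "signed_area A C X = (1 - t) * sB + t * sD"
    unfolding X' signed_area_affine sB_def sD_def ..
  also have "\<dots> = 0" using ne by (simp add: t_def field_simps)
  finally have "X \<in> affine hull {A, C}"
    using dist affine_hull_2_iff_signed_area[of A C X] by simp
  then obtain r :: real where "X = A + of_real r * (C - A)"
    unfolding affine_hull_2_alt by (auto simp: scaleR_conv_of_real)
  then have AC: "X + A * C * cnj X = A + C"
    using chord_equation circle by blast
  have BD: "X + B * D * cnj X = B + D"
    using chord_equation circle X_def by blast
  \<comment> \<open>Strict convexity of the disc: an inner point of a chord is an interior point.\<close>
  have "(norm X)\<^sup>2 = (1 - t) * (norm B)\<^sup>2 + t * (norm D)\<^sup>2 - t * (1 - t) * (norm (B - D))\<^sup>2"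
    unfolding X_def cmod_power2 by (simp add: power2_eq_square algebra_simps)
  moreover have "t * (1 - t) * (norm (B - D))\<^sup>2 > 0"
    using t dist by simp
  ultimately have "(norm X)\<^sup>2 < 1" using circle by simp
  then have "norm X < 1" by (simp add: abs_square_less_1)
  then obtain p where p: "norm p < 1" "X * (1 + p * cnj p) = 2 * p"
    using hyperbolic_point_of_klein_point by blast
  define a where "a = disc_involution p A"
  define b where "b = disc_involution p B"
  have ab: "norm a = 1" "norm b = 1"
    using disc_involution_sphere[OF p(1)] circle by (auto simp: a_def b_def)
  have inv: "A = disc_involution p a" "B = disc_involution p b"
    "C = disc_involution p (- a)" "D = disc_involution p (- b)"
    using disc_involution_idem[OF p(1)] circle disc_involution_antipodal[OF p circle(1,3) AC]
      disc_involution_antipodal[OF p circle(2,4) BD] unfolding a_def b_def by (metis order_refl)+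
  \<comment> \<open>The images are \<open>a, b, - a, - b\<close>. Up to sign \<open>\<rho>\<close> is the direction halfway between
    \<open>a\<close> and \<open>b\<close>, so dividing by it makes them conjugate to each other.\<close>
  define \<rho> where "\<rho> = csqrt (a * b)"
  have \<rho>2: "\<rho> * \<rho> = a * b" unfolding \<rho>_def by (metis power2_csqrt power2_eq_square)
  then have "norm \<rho> * norm \<rho> = 1" using ab by (metis norm_mult mult_1)
  then have \<rho>: "norm \<rho> = 1" by (metis norm_ge_zero power2_eq_square real_sqrt_abs real_sqrt_one abs_of_nonneg)
  define u where "u = cnj \<rho> * a"
  have \<rho>\<rho>: "\<rho> * cnj \<rho> = 1" and aa: "a * cnj a = 1" using \<rho> ab norm_eq_1_iff_cnj by auto
  have au: "a = \<rho> * u"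
    unfolding u_def using \<rho>\<rho> by (simp add: mult.assoc[symmetric])
  have "\<rho> * cnj u = \<rho> * \<rho> * cnj a" by (simp add: u_def)
  also have "\<dots> = a * cnj a * b" unfolding \<rho>2 by simp
  finally have bu: "b = \<rho> * cnj u" using aa by simp
  have u: "norm u = 1" using ab \<rho> by (simp add: u_def norm_mult)
  have "Re u \<noteq> 0"
  proof
    assume "Re u = 0"
    then have "u = - cnj u" by (simp add: complex_eq_iff)
    then have "a = - b" unfolding au bu by (metis mult_minus_right)
    then show False using inv dist by auto
  qed
  moreover have "Im u \<noteq> 0"
  proof
    assume "Im u = 0"
    then have "u = cnj u" by (simp add: complex_eq_iff)
    then have "a = b" unfolding au bu by simp
    then show False using inv dist by auto
  qed
  moreover have rotated: "disc_involution p (\<rho> * z) = \<rho> * disc_involution (cnj \<rho> * p) z" for z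
    using disc_involution_rotate[OF \<rho>, of "cnj \<rho> * p" z] \<rho>\<rho> by (simp add: mult.assoc[symmetric])
  have "T = moebius_rectangle c \<rho> (cnj \<rho> * p) u"
    unfolding T moebius_rectangle_def inv au bu by (simp only: rotated mult_minus_right[symmetric])
  moreover have "norm (cnj \<rho> * p) < 1" using p \<rho> by (simp add: norm_mult)
  ultimately show thesis using that \<rho> u by blast
qed

section \<open>One step of the iteration\<close>

text \<open>This is the map \<open>p \<mapsto> q * (k - q\<^sup>2) / (1 - k * q\<^sup>2)\<close> with \<open>q = cnj p\<close>, written so that
the factor of \<open>q\<close> is visibly a disc automorphism.\<close>

definition next_parameter :: "real \<Rightarrow> complex \<Rightarrow> complex" where
  "next_parameter k p = cnj p * disc_involution (of_real k) ((cnj p)\<^sup>2)"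

lemma norm_power2_less_1: "norm (p::complex) < 1 \<Longrightarrow> norm (p\<^sup>2) < 1"
  by (simp add: norm_power abs_square_less_1)

lemma next_parameter_disc:
  assumes "\<bar>k\<bar> < 1" "norm p < 1"
  shows "norm (next_parameter k p) < 1"
proof -
  have "norm (disc_involution (of_real k) ((cnj p)\<^sup>2)) < 1"
    using assms norm_power2_less_1[of "cnj p"] by (intro disc_involution_disc) auto
  then show ?thesis
    using assms mult_strict_mono'[of "norm p" 1 "norm (disc_involution (of_real k) ((cnj p)\<^sup>2))" 1]
    by (simp add: next_parameter_def norm_mult)
qed

lemma abs_Re_square_less_1:
  assumes "norm u = 1" "Re u \<noteq> 0" "Im u \<noteq> 0"
  shows "\<bar>Re (u\<^sup>2)\<bar> < 1"
proof -
  have "(Re u)\<^sup>2 + (Im u)\<^sup>2 = 1" using assms cmod_power2[of u] by simp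
  moreover have "(Re u)\<^sup>2 > 0" "(Im u)\<^sup>2 > 0" using assms by auto
  ultimately show ?thesis by (simp add: power2_eq_square abs_if)
qed

text \<open>This identity determines the dynamics. Opposite vertices are added first, since their sum depends only on \<open>u\<^sup>2\<close>
and on \<open>v\<^sup>2\<close>, where \<open>v = cnj u\<close>; then \<open>u * v = 1\<close> and \<open>u\<^sup>2 + v\<^sup>2 = 2 * k\<close>
remove \<open>u\<close> altogether. As the involution is its own inverse, the statement is equivalent to a formula for
\<open>disc_involution p g\<close>, where \<open>g\<close> is the centroid for \<open>\<rho> = 1\<close>.\<close>

lemma centroid_moebius_rectangle:
  assumes \<rho>: "norm \<rho> = 1" and p: "norm p < 1" and u: "norm u = 1" "Re u \<noteq> 0" "Im u \<noteq> 0"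
  shows "centroid (moebius_rectangle c \<rho> p u)
    = c + \<rho> * disc_involution p (next_parameter (Re (u\<^sup>2)) p)"
proof -
  define k where "k = complex_of_real (Re (u\<^sup>2))"
  define q where "q = cnj p"
  define v where "v = cnj u"
  have k: "norm k < 1" using abs_Re_square_less_1[OF u] by (simp add: k_def)
  have q: "norm q < 1" "norm (q\<^sup>2) < 1" using p norm_power2_less_1[of q] by (simp_all add: q_def)
  have uv: "u * v = 1" using u norm_eq_1_iff_cnj by (simp add: v_def)
  have kk: "2 * k = u\<^sup>2 + v\<^sup>2"
    using complex_add_cnj[of "u\<^sup>2"] by (simp add: k_def v_def)
  have v: "norm v = 1" using u by (simp add: v_def)
  have nz: "1 - q * u \<noteq> 0" "1 - q * v \<noteq> 0" "1 + q * u \<noteq> 0" "1 + q * v \<noteq> 0"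
    using disc_involution_denominator_nonzero[OF p, of u] disc_involution_denominator_nonzero[OF p, of v]
      disc_involution_denominator_nonzero[OF p, of "- u"] disc_involution_denominator_nonzero[OF p, of "- v"] u v
    by (auto simp: q_def)
  have nzk: "1 - k * q\<^sup>2 \<noteq> 0"
    using disc_involution_denominator_nonzero[OF k, of "q\<^sup>2"] q by (simp add: k_def)
  define E where "E = 1 - 2 * k * q\<^sup>2 + q ^ 4"
  have E: "E = (1 - q * u) * (1 + q * u) * ((1 - q * v) * (1 + q * v))"
  proof -
    have "E = 1 - (u\<^sup>2 + v\<^sup>2) * q\<^sup>2 + (u * v)\<^sup>2 * q ^ 4"
      unfolding E_def kk uv by simp
    then show ?thesis by (simp add: algebra_simps power2_eq_square power4_eq_xxxx)
  qed
  have E0: "E \<noteq> 0" unfolding E using nz by simp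
  have pair: "disc_involution p x + disc_involution p (- x) = 2 * (p - q * x\<^sup>2) / ((1 - q * x) * (1 + q * x))"
    if "1 - q * x \<noteq> 0" "1 + q * x \<noteq> 0" for x
    using that unfolding disc_involution_def q_def[symmetric]
    by (simp add: divide_simps) (simp add: algebra_simps power2_eq_square)
  have "(p - q * u\<^sup>2) * ((1 - q * v) * (1 + q * v)) + (p - q * v\<^sup>2) * ((1 - q * u) * (1 + q * u))
      = 2 * p - p * q\<^sup>2 * (u\<^sup>2 + v\<^sup>2) - q * (u\<^sup>2 + v\<^sup>2) + 2 * q ^ 3 * (u * v)\<^sup>2"
    by (simp add: algebra_simps power2_eq_square power3_eq_cube)
  also have "\<dots> = 2 * (p - k * p * q\<^sup>2 - k * q + q ^ 3)"
    unfolding kk[symmetric] uv by (simp add: algebra_simps)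
  finally have num: "(p - q * u\<^sup>2) * ((1 - q * v) * (1 + q * v)) + (p - q * v\<^sup>2) * ((1 - q * u) * (1 + q * u))
      = 2 * (p - k * p * q\<^sup>2 - k * q + q ^ 3)" .
  have "(disc_involution p u + disc_involution p (- u)) + (disc_involution p v + disc_involution p (- v))
      = 2 * ((p - q * u\<^sup>2) * ((1 - q * v) * (1 + q * v)) + (p - q * v\<^sup>2) * ((1 - q * u) * (1 + q * u))) / E"
    unfolding pair[OF nz(1,3)] pair[OF nz(2,4)] E using nz by (simp add: divide_simps) (simp add: algebra_simps)
  also have "\<dots> = 4 * ((p - k * p * q\<^sup>2 - k * q + q ^ 3) / E)"
    unfolding num by simp
  also have "(p - k * p * q\<^sup>2 - k * q + q ^ 3) / E = disc_involution p (next_parameter (Re (u\<^sup>2)) p)"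
  proof -
    have n: "next_parameter (Re (u\<^sup>2)) p = q * (k - q\<^sup>2) / (1 - k * q\<^sup>2)"
      by (simp add: next_parameter_def disc_involution_def k_def q_def)
    have "p - q * (k - q\<^sup>2) / (1 - k * q\<^sup>2) = (p - k * p * q\<^sup>2 - k * q + q ^ 3) / (1 - k * q\<^sup>2)"
      using nzk by (simp add: field_simps power2_eq_square power3_eq_cube)
    moreover have "1 - q * (q * (k - q\<^sup>2) / (1 - k * q\<^sup>2)) = E / (1 - k * q\<^sup>2)"
      using nzk by (simp add: E_def field_simps power2_eq_square power4_eq_xxxx)
    ultimately show ?thesis
      unfolding n disc_involution_def q_def[symmetric] using nzk by simp
  qed
  finally have "disc_involution p u + disc_involution p v + disc_involution p (- u) + disc_involution p (- v)
      = 4 * disc_involution p (next_parameter (Re (u\<^sup>2)) p)"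
    by (simp add: add_ac)
  moreover have "centroid (moebius_rectangle c \<rho> p u)
      = c + \<rho> * (disc_involution p u + disc_involution p v + disc_involution p (- u) + disc_involution p (- v)) / 4"
    unfolding moebius_rectangle_def centroid_eq v_def by (simp add: field_simps)
  ultimately show ?thesis by simp
qed

text \<open>The unit factor is the one in \<open>disc_involution_compose\<close>, with the next parameter as \<open>q\<close>.\<close>

definition next_rotation :: "real \<Rightarrow> complex \<Rightarrow> complex \<Rightarrow> complex" where
  "next_rotation k \<rho> p = - \<rho> * ((1 - p * cnj (next_parameter k p)) / (1 - cnj p * next_parameter k p))"

lemma norm_next_rotation:
  assumes "\<bar>k\<bar> < 1" "norm p < 1" "norm \<rho> = 1"
  shows "norm (next_rotation k \<rho> p) = 1"
proof -
  let ?d = "1 - cnj p * next_parameter k p"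
  have "?d \<noteq> 0"
    using disc_involution_denominator_nonzero next_parameter_disc assms less_imp_le by blast
  moreover have "1 - p * cnj (next_parameter k p) = cnj ?d" by simp
  ultimately show ?thesis
    using assms unfolding next_rotation_def by (simp only: norm_mult norm_minus_cancel norm_divide complex_mod_cnj) simp
qed

text \<open>The centroid has the form \<open>\<rho> * disc_involution p p'\<close>, so that the composition law applies with \<open>q = p'\<close>.\<close>

lemma next_quad_moebius_rectangle:
  assumes \<rho>: "norm \<rho> = 1" and p: "norm p < 1" and u: "norm u = 1" "Re u \<noteq> 0" "Im u \<noteq> 0"
  defines "k \<equiv> Re (u\<^sup>2)"
  shows "next_quad_well_defined c (moebius_rectangle c \<rho> p u)"
    and "next_quad c (moebius_rectangle c \<rho> p u)
      = moebius_rectangle c (next_rotation k \<rho> p) (next_parameter k p) u"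
proof -
  let ?T = "moebius_rectangle c \<rho> p u"
  let ?p' = "next_parameter k p"
  have k: "\<bar>k\<bar> < 1" unfolding k_def by (rule abs_Re_square_less_1[OF u])
  have p': "norm ?p' < 1" using next_parameter_disc[OF k p] .
  have G: "centroid ?T - c = \<rho> * disc_involution p ?p'"
    using centroid_moebius_rectangle[OF \<rho> p u] by (simp add: k_def)
  have inside: "norm (centroid ?T - c) < 1"
    unfolding G using disc_involution_disc[OF p p'] \<rho> by (simp add: norm_mult)
  have inter: "second_intersection c (centroid ?T) (c + \<rho> * disc_involution p z) P \<longleftrightarrow>
      P = c + next_rotation k \<rho> p * disc_involution ?p' z" if z: "norm z = 1" for z P
  proof -
    have "norm (c + \<rho> * disc_involution p z - c) = 1"
      using disc_involution_sphere[OF p z] \<rho> by (simp add: norm_mult)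
    note second_intersection_iff[OF this inside, of P]
    also have "disc_involution (centroid ?T - c) (c + \<rho> * disc_involution p z - c)
        = \<rho> * disc_involution (disc_involution p ?p') (disc_involution p z)"
      unfolding G using disc_involution_rotate[OF \<rho>] by simp
    also have "\<dots> = next_rotation k \<rho> p * disc_involution ?p' z"
      using z unfolding next_rotation_def disc_involution_compose[OF p p' eq_refl[OF z]]
      by (simp only: minus_divide_left[symmetric] mult_minus_left mult_minus_right mult.assoc)
    finally show ?thesis .
  qed
  have range: "{1..4} = {1, 2, 3, 4::nat}" by auto
  have vertex_eq: "vertex ?T 1 = c + \<rho> * disc_involution p u"
    "vertex ?T 2 = c + \<rho> * disc_involution p (cnj u)"
    "vertex ?T 3 = c + \<rho> * disc_involution p (- u)"
    "vertex ?T 4 = c + \<rho> * disc_involution p (- cnj u)"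
    by (simp_all add: moebius_rectangle_def)
  have "centroid ?T \<noteq> c + \<rho> * disc_involution p z" if z: "norm z = 1" for z
    using inside disc_involution_sphere[OF p z] \<rho> by (auto simp: norm_mult)
  moreover have "\<exists>!P. second_intersection c (centroid ?T) (c + \<rho> * disc_involution p z) P"
    if "norm z = 1" for z
    unfolding inter[OF that] by blast
  ultimately show "next_quad_well_defined c ?T"
    unfolding next_quad_well_defined_def range using u
    by (simp add: vertex_eq vertex_eq(1)[unfolded One_nat_def])
  show "next_quad c ?T = moebius_rectangle c (next_rotation k \<rho> p) ?p' u"
  proof -
    have "(THE P. second_intersection c (centroid ?T) (c + \<rho> * disc_involution p z) P)
        = c + next_rotation k \<rho> p * disc_involution ?p' z" if "norm z = 1" for z
      unfolding inter[OF that] by simp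
    then show ?thesis
      unfolding next_quad_def next_vertex_def vertex_eq
        moebius_rectangle_def[of c "next_rotation k \<rho> p"]
      using u by simp
  qed
qed

text \<open>A distance of two images is the original distance times a factor for each of the two points, and these factors
cancel in this ratio, which is the absolute cross-ratio of the vertices. It remains to evaluate it
for the rectangle, whose diagonals have length \<open>2\<close> and whose sides \<open>12\<close> and \<open>34\<close>
have length \<open>2 * \<bar>Im u\<bar>\<close>.\<close>

lemma sqlen_ratio_moebius_rectangle:
  fixes c :: complex
  assumes \<rho>: "norm \<rho> = 1" and p: "norm p < 1" and u: "norm u = 1"
  defines "T \<equiv> moebius_rectangle c \<rho> p u"
  shows "sqrt (sqlen T 1 2 * sqlen T 3 4) / sqrt (sqlen T 1 3 * sqlen T 2 4) = (Im u)\<^sup>2"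
proof -
  define d where "d z = norm (1 - cnj p * z)" for z
  define E where "E = norm (1 - p * cnj p)"
  have E: "E \<noteq> 0" using one_minus_norm_sq_nonzero[OF p] by (simp add: E_def)
  have d: "d z \<noteq> 0" if "norm z = 1" for z
    using disc_involution_denominator_nonzero[OF p] that by (auto simp: d_def)
  define V where "V z = c + \<rho> * disc_involution p z" for z
  have len: "dist (V x) (V y) = norm (y - x) * E / (d x * d y)" if "norm x = 1" "norm y = 1" for x y
  proof -
    have "dist (V x) (V y) = norm (\<rho> * (disc_involution p x - disc_involution p y))"
      by (simp add: V_def dist_norm right_diff_distrib)
    then show ?thesis
      using that \<rho> unfolding disc_involution_diff[OF p eq_refl[OF that(1)] eq_refl[OF that(2)]]
      by (simp add: norm_mult norm_divide d_def E_def)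
  qed
  have sq: "sqrt (x\<^sup>2 * y\<^sup>2) = x * y" if "x \<ge> 0" "y \<ge> 0" for x y :: real
    using that by (simp add: real_sqrt_mult)
  have "norm (cnj u - u) = 2 * \<bar>Im u\<bar>" "norm (- cnj u - - u) = 2 * \<bar>Im u\<bar>"
    using real_sqrt_abs[of "2 * Im u"] by (simp_all add: cmod_def)
  moreover have "norm (- u - u) = 2" "norm (- cnj u - cnj u) = 2"
    using u norm_mult[of 2 u] norm_mult[of 2 "cnj u"]
    by (simp_all add: norm_minus_commute[of "- _"] flip: mult_2 norm_minus_cancel[of "- _ - _"])
  moreover have len2: "sqlen T 1 2 = (dist (V u) (V (cnj u)))\<^sup>2"
    "sqlen T 3 4 = (dist (V (- u)) (V (- cnj u)))\<^sup>2"
    "sqlen T 1 3 = (dist (V u) (V (- u)))\<^sup>2" "sqlen T 2 4 = (dist (V (cnj u)) (V (- cnj u)))\<^sup>2"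
    by (simp_all add: T_def sqlen_def moebius_rectangle_def V_def)
  ultimately show ?thesis
    unfolding len2 sq[OF zero_le_dist zero_le_dist]
    using d[of u] d[of "cnj u"] d[of "- u"] d[of "- cnj u"] E u
    by (simp add: len divide_simps) (simp add: power2_eq_square)
qed

section \<open>Geometric bounds\<close>

text \<open>A disc automorphism maps a smaller concentric disc into a disc of radius less than \<open>1\<close>; here the
smaller disc has radius \<open>r\<^sup>2\<close>, because the automorphism is applied to \<open>(cnj p)\<^sup>2\<close>. Hence the
contraction is global and needs no initial closeness to \<open>0\<close>.\<close>

lemma next_parameter_contraction:
  assumes k: "\<bar>k\<bar> < 1" and r: "0 \<le> r" "r < 1"
  obtains \<kappa> where "0 < \<kappa>" "\<kappa> < 1"
    "\<And>p. norm p \<le> r \<Longrightarrow> norm (next_parameter k p) \<le> \<kappa> * norm p"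
proof -
  \<comment> \<open>The squared denominator of the automorphism is at most \<open>4\<close>.\<close>
  define \<delta> where "\<delta> = (1 - k\<^sup>2) * (1 - (r\<^sup>2)\<^sup>2) / 4"
  have k2: "0 \<le> k\<^sup>2" "k\<^sup>2 < 1" using k by (simp_all add: abs_square_less_1)
  have r2: "0 \<le> r\<^sup>2" "r\<^sup>2 < 1" using r by (simp_all add: abs_square_less_1)
  then have r4: "(r\<^sup>2)\<^sup>2 < 1" by (subst abs_square_less_1) simp
  have "(1 - k\<^sup>2) * (1 - (r\<^sup>2)\<^sup>2) \<le> 1 * 1" using k2 r4 by (intro mult_mono) auto
  moreover have "0 < (1 - k\<^sup>2) * (1 - (r\<^sup>2)\<^sup>2)" using k2 r4 by simp
  ultimately have \<delta>: "0 < \<delta>" "\<delta> < 1" by (simp_all add: \<delta>_def)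
  show thesis
  proof (rule that)
    show "0 < sqrt (1 - \<delta>)" "sqrt (1 - \<delta>) < 1" using \<delta> by simp_all
    fix p :: complex assume p: "norm p \<le> r"
    let ?w = "(cnj p)\<^sup>2"
    have w: "norm ?w \<le> r\<^sup>2" using p by (simp add: norm_power power_mono)
    then have w1: "norm ?w < 1" using r2 by simp
    have kc: "norm (complex_of_real k) < 1" using k by simp
    let ?d = "norm (1 - cnj (complex_of_real k) * ?w)"
    have d: "?d > 0" using disc_involution_denominator_nonzero[OF kc less_imp_le[OF w1]] by simp
    have "?d \<le> 1 + norm (cnj (complex_of_real k) * ?w)"
      by (metis norm_one norm_triangle_ineq4)
    also have "norm (cnj (complex_of_real k) * ?w) \<le> 1 * 1"
      unfolding norm_mult using k w1 by (intro mult_mono) auto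
    finally have "?d\<^sup>2 \<le> 2\<^sup>2" using d by (intro power_mono) auto
    moreover have "(norm ?w)\<^sup>2 \<le> (r\<^sup>2)\<^sup>2" using w by (intro power_mono) auto
    ultimately have "\<delta> \<le> (1 - k\<^sup>2) * (1 - (norm ?w)\<^sup>2) / ?d\<^sup>2"
      unfolding \<delta>_def using k2 r4 d by (intro frac_le mult_left_mono mult_nonneg_nonneg) auto
    then have "(norm (disc_involution (of_real k) ?w))\<^sup>2 \<le> 1 - \<delta>"
      unfolding norm_disc_involution_sq[OF kc less_imp_le[OF w1]] by simp
    then have "norm (disc_involution (of_real k) ?w) \<le> sqrt (1 - \<delta>)"
      by (rule real_le_rsqrt)
    then show "norm (next_parameter k p) \<le> sqrt (1 - \<delta>) * norm p"
      unfolding next_parameter_def norm_mult complex_mod_cnj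
      by (subst mult.commute) (rule mult_right_mono, auto)
  qed
qed

text \<open>The increments are dominated by a contracting sequence \<open>e\<close>, so the tail that starts at \<open>n\<close> is bounded by a
geometric series with first term \<open>M * e n\<close>. The telescoping form of the bound in the proof avoids the
series.\<close>

lemma convergent_of_contracting_increments:
  fixes x :: "nat \<Rightarrow> 'a::banach" and e :: "nat \<Rightarrow> real"
  assumes q: "0 \<le> q" "q < 1" and e: "\<And>n. e n \<ge> 0" "\<And>n. e (Suc n) \<le> q * e n"
    and x: "\<And>n. dist (x (Suc n)) (x n) \<le> M * e n" and M: "M \<ge> 0"
  obtains l where "\<And>n. dist (x n) l \<le> M / (1 - q) * e n" "x \<longlonglongrightarrow> l"
proof -
  have bound: "dist (x (n + j)) (x n) \<le> M / (1 - q) * (e n - e (n + j))" for n j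
  proof (induction j)
    case 0
    show ?case by simp
  next
    case (Suc j)
    have "(1 - q) * e (n + j) \<le> e (n + j) - e (n + Suc j)"
      using e(2)[of "n + j"] by (simp add: algebra_simps)
    then have "M * ((1 - q) * e (n + j)) \<le> M * (e (n + j) - e (n + Suc j))"
      using M by (rule mult_left_mono)
    then have "M * e (n + j) \<le> M / (1 - q) * (e (n + j) - e (n + Suc j))"
      using q by (simp add: field_simps)
    moreover have "dist (x (n + Suc j)) (x n) \<le> dist (x (n + Suc j)) (x (n + j)) + dist (x (n + j)) (x n)"
      by (rule dist_triangle)
    moreover have "dist (x (n + Suc j)) (x (n + j)) \<le> M * e (n + j)" using x[of "n + j"] by simp
    ultimately show ?case using Suc.IH by (simp add: algebra_simps add_divide_distrib diff_divide_distrib)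
  qed
  have K: "M / (1 - q) \<ge> 0" using M q by simp
  have bound': "dist (x (n + j)) (x n) \<le> M / (1 - q) * e n" for n j
  proof -
    have "M / (1 - q) * (e n - e (n + j)) \<le> M / (1 - q) * e n"
      using K e(1)[of "n + j"] by (intro mult_left_mono) auto
    then show ?thesis using bound[where n = n and j = j] by linarith
  qed
  have "e n \<le> q ^ n * e 0" for n
    by (induction n) (use q e in \<open>auto intro: order_trans[OF e(2)] mult_left_mono simp: mult.assoc\<close>)
  moreover have "(\<lambda>n. q ^ n * e 0) \<longlonglongrightarrow> 0 * e 0"
    using q by (intro tendsto_intros LIMSEQ_power_zero) auto
  ultimately have e0: "e \<longlonglongrightarrow> 0"
    using e(1) by (intro tendsto_sandwich[of "\<lambda>_. 0" e sequentially "\<lambda>n. q ^ n * e 0" 0]) auto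
  have "Cauchy x"
  proof (rule metric_CauchyI)
    fix \<epsilon> :: real assume \<epsilon>: "\<epsilon> > 0"
    have "(\<lambda>n. M / (1 - q) * e n) \<longlonglongrightarrow> M / (1 - q) * 0" by (intro tendsto_intros e0)
    then have "eventually (\<lambda>n. M / (1 - q) * e n < \<epsilon> / 2) sequentially"
      using \<epsilon> by (intro order_tendstoD(2)[where y = 0]) auto
    then obtain N where N: "M / (1 - q) * e N < \<epsilon> / 2"
      by (auto simp: eventually_sequentially)
    have near: "dist (x m) (x N) < \<epsilon> / 2" if "m \<ge> N" for m
      using le_less_trans[OF bound'[of N "m - N"] N] that by simp
    show "\<exists>N. \<forall>m\<ge>N. \<forall>n\<ge>N. dist (x m) (x n) < \<epsilon>"
      using near dist_triangle_half_l by blast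
  qed
  then obtain l where l: "x \<longlonglongrightarrow> l" using Cauchy_convergent convergent_def by blast
  have "dist (x n) l \<le> M / (1 - q) * e n" for n
  proof (rule tendsto_upperbound)
    show "(\<lambda>j. dist (x n) (x (n + j))) \<longlonglongrightarrow> dist (x n) l"
      using LIMSEQ_ignore_initial_segment[OF l, of n] by (intro tendsto_intros) (simp add: add.commute)
    show "\<forall>\<^sub>F j in sequentially. dist (x n) (x (n + j)) \<le> M / (1 - q) * e n"
      using bound' by (simp add: dist_commute)
  qed auto
  then show thesis using that l by blast
qed

lemma bigo_geometric_of_eventual_contraction:
  fixes e :: "nat \<Rightarrow> real"
  assumes q: "q > 0" and e: "\<And>n. e n \<ge> 0" and contr: "\<forall>\<^sub>F n in sequentially. e (Suc n) \<le> q * e n"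
  shows "e \<in> O(\<lambda>n. q ^ n)"
proof -
  obtain N where N: "\<And>n. n \<ge> N \<Longrightarrow> e (Suc n) \<le> q * e n"
    using contr by (auto simp: eventually_sequentially)
  have "e n \<le> e N / q ^ N * q ^ n" if "n \<ge> N" for n
    using that
  proof (induction n rule: dec_induct)
    case base
    show ?case using q by simp
  next
    case (step n)
    have "q * e n \<le> q * (e N / q ^ N * q ^ n)" using q step.IH by (intro mult_left_mono) auto
    then show ?case using N[OF step.hyps(1)] by (simp add: mult_ac)
  qed
  then show ?thesis
    using q e by (intro bigoI[of _ "e N / q ^ N"]) (auto simp: eventually_sequentially)
qed

lemma bigo_geometric_reindex:
  fixes e :: "nat \<Rightarrow> real"
  assumes "e \<in> O(\<lambda>n. q ^ n)" "0 < q" "q < 1" "\<And>i. i \<le> h i"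
  shows "(\<lambda>i. e (h i)) \<in> O(\<lambda>i. q ^ i)"
proof -
  have "filterlim h at_top sequentially"
    using assms(4) by (intro filterlim_at_top_mono[OF filterlim_ident]) auto
  then have "(\<lambda>i. e (h i)) \<in> O(\<lambda>i. q ^ h i)"
    using assms(1) by (rule landau_o.big.compose[rotated])
  also have "(\<lambda>i. q ^ h i) \<in> O(\<lambda>i. q ^ i)"
    using assms by (intro bigoI[of _ 1]) (auto intro!: power_decreasing)
  finally show ?thesis .
qed

lemma smallo_of_vanishing_ratio:
  fixes f g \<eta> :: "nat \<Rightarrow> real"
  assumes "\<And>n. \<bar>f n\<bar> \<le> \<bar>g n\<bar> * \<eta> n" "\<eta> \<longlonglongrightarrow> 0"
  shows "f \<in> o(g)"
proof (rule landau_o.smallI)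
  fix \<epsilon> :: real assume "\<epsilon> > 0"
  then have "\<forall>\<^sub>F n in sequentially. \<eta> n < \<epsilon>" using assms(2) by (rule order_tendstoD(2)[rotated])
  then show "\<forall>\<^sub>F n in sequentially. norm (f n) \<le> \<epsilon> * norm (g n)"
  proof (eventually_elim)
    case (elim n)
    have "\<bar>g n\<bar> * \<eta> n \<le> \<bar>g n\<bar> * \<epsilon>" using elim by (intro mult_left_mono) auto
    then show ?case using assms(1)[of n] by (simp add: mult.commute)
  qed
qed

section \<open>The parameter along an orbit\<close>

locale parameter_orbit =
  fixes k :: real and p :: "nat \<Rightarrow> complex"
  assumes k: "\<bar>k\<bar> < 1" and p0: "norm (p 0) < 1"
    and p_Suc: "\<And>n. p (Suc n) = next_parameter k (p n)"
begin

text \<open>The norm of the centroid for the parameter \<open>p n\<close>, measured from the center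
(see \<open>centroid_moebius_rectangle\<close>).\<close>

definition gap :: "nat \<Rightarrow> real" where
  "gap n = norm (disc_involution (p n) (p (Suc n)))"

lemma obtain_rate:
  obtains \<kappa> where "0 < \<kappa>" "\<kappa> < 1" "\<And>n. norm (p (Suc n)) \<le> \<kappa> * norm (p n)"
    "\<And>n. norm (p n) \<le> norm (p 0)"
proof -
  obtain \<kappa> where \<kappa>: "0 < \<kappa>" "\<kappa> < 1"
    "\<And>z. norm z \<le> norm (p 0) \<Longrightarrow> norm (next_parameter k z) \<le> \<kappa> * norm z"
    using next_parameter_contraction[OF k norm_ge_zero p0] by metis
  have "norm (p n) \<le> norm (p 0)" for n
  proof (induction n)
    case (Suc n)
    have "norm (p (Suc n)) \<le> \<kappa> * norm (p n)" unfolding p_Suc by (rule \<kappa>(3)[OF Suc])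
    also have "\<dots> \<le> 1 * norm (p n)" using \<kappa> by (intro mult_right_mono) auto
    finally show ?case using Suc by simp
  qed simp
  then show thesis using that[OF \<kappa>(1,2)] \<kappa>(3) p_Suc by metis
qed

lemma p_in_disc: "norm (p n) < 1"
proof -
  have "norm (p n) \<le> norm (p 0)" by (rule obtain_rate) blast
  then show ?thesis using p0 by linarith
qed

lemma p_bigo: obtains q where "0 < q" "q < 1" "(\<lambda>n. norm (p n)) \<in> O(\<lambda>n. q ^ n)"
proof -
  obtain \<kappa> where \<kappa>: "0 < \<kappa>" "\<kappa> < 1" "\<And>n. norm (p (Suc n)) \<le> \<kappa> * norm (p n)"
    using obtain_rate by metis
  have "(\<lambda>n. norm (p n)) \<in> O(\<lambda>n. \<kappa> ^ n)"
    by (rule bigo_geometric_of_eventual_contraction) (use \<kappa> in auto)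
  then show thesis using that \<kappa> by blast
qed

lemma p_tendsto: "p \<longlonglongrightarrow> 0"
proof -
  obtain q where q: "0 < q" "q < 1" "(\<lambda>n. norm (p n)) \<in> O(\<lambda>n. q ^ n)" by (rule p_bigo)
  have "(\<lambda>n. q ^ n) \<longlonglongrightarrow> 0" using q by (intro LIMSEQ_power_zero) auto
  then have "(\<lambda>n. q ^ n) \<in> o(\<lambda>_. 1)" by (intro smalloI_tendsto) auto
  with q(3) have "(\<lambda>n. norm (p n)) \<in> o(\<lambda>_. 1)" by (rule landau_o.big_small_trans)
  then have "(\<lambda>n. norm (p n)) \<longlonglongrightarrow> 0"
    using smalloD_tendsto by fastforce
  then show ?thesis by (rule tendsto_norm_zero_cancel)
qed

abbreviation "factor n \<equiv> disc_involution (of_real k) ((cnj (p n))\<^sup>2)"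

lemma p_Suc_factor: "p (Suc n) = cnj (p n) * factor n"
  by (simp add: p_Suc next_parameter_def)

lemma factor_tendsto: "(\<lambda>n. factor n) \<longlonglongrightarrow> of_real k"
proof -
  have "(\<lambda>n. (of_real k - (cnj (p n))\<^sup>2) / (1 - cnj (of_real k) * (cnj (p n))\<^sup>2)) \<longlonglongrightarrow>
      (of_real k - (cnj 0)\<^sup>2) / (1 - cnj (of_real k) * (cnj 0)\<^sup>2)"
    by (intro tendsto_intros p_tendsto) auto
  then show ?thesis by (simp add: disc_involution_def)
qed

lemma gap_eq: "gap n = norm (p n - p (Suc n)) / norm (1 - cnj (p n) * p (Suc n))"
  by (simp add: gap_def disc_involution_def norm_divide)

lemma gap_denominator_tendsto: "(\<lambda>n. norm (1 - cnj (p n) * p (Suc n))) \<longlonglongrightarrow> 1"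
proof -
  have "(\<lambda>n. norm (1 - cnj (p n) * p (Suc n))) \<longlonglongrightarrow> norm (1 - cnj 0 * (0::complex))"
    by (intro tendsto_intros p_tendsto LIMSEQ_Suc)
  then show ?thesis by simp
qed

lemma gap_denominator_pos: "norm (1 - cnj (p n) * p (Suc n)) > 0"
  using disc_involution_denominator_nonzero[OF p_in_disc less_imp_le[OF p_in_disc]] by simp

text \<open>Up to the denominator, which tends to \<open>1\<close>, the gap is \<open>w n = norm (p n - p (Suc n))\<close>. To first order
\<open>p (Suc n)\<close> is \<open>k * cnj (p n)\<close>, hence \<open>p (Suc n) - p (Suc (Suc n))\<close> is \<open>k * cnj (p n - p (Suc n))\<close>,
with an error that is small relative to \<open>p n\<close>. Because the map is a contraction, \<open>w n\<close> is not
smaller than a fixed multiple of \<open>norm (p n)\<close>, so the error is also small relative to \<open>w n\<close>. For \<open>k = 0\<close> the statement is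
the superlinear convergence of the square case.\<close>

lemma gap_smallo: "(\<lambda>n. gap (Suc n) - \<bar>k\<bar> * gap n) \<in> o(gap)"
proof -
  obtain \<kappa> where \<kappa>: "0 < \<kappa>" "\<kappa> < 1" and contr: "\<And>n. norm (p (Suc n)) \<le> \<kappa> * norm (p n)"
    using obtain_rate by metis
  define m where "m n = norm (1 - cnj (p n) * p (Suc n))" for n
  define w where "w n = norm (p n - p (Suc n))" for n
  define \<delta> where "\<delta> n = norm (factor n - of_real k) + norm (factor (Suc n) - of_real k)" for n
  define \<eta> where "\<eta> n = m n * (\<delta> n / (1 - \<kappa>) / m (Suc n) + \<bar>k\<bar> * \<bar>1 / m (Suc n) - 1 / m n\<bar>)" for n
  have m0: "m n > 0" for n unfolding m_def by (rule gap_denominator_pos)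
  have m_lim: "m \<longlonglongrightarrow> 1" unfolding m_def by (rule gap_denominator_tendsto)
  have gap: "gap n = w n / m n" for n by (simp add: gap_eq w_def m_def)
  have "\<delta> \<longlonglongrightarrow> norm (of_real k - complex_of_real k) + norm (of_real k - complex_of_real k)"
    unfolding \<delta>_def by (intro tendsto_intros factor_tendsto LIMSEQ_Suc)
  then have \<delta>_lim: "\<delta> \<longlonglongrightarrow> 0" by simp
  have "\<eta> \<longlonglongrightarrow> 1 * (0 / (1 - \<kappa>) / 1 + \<bar>k\<bar> * \<bar>1 / 1 - 1 / 1\<bar>)"
    unfolding \<eta>_def using \<kappa> by (intro tendsto_intros m_lim \<delta>_lim LIMSEQ_Suc) auto
  then have \<eta>_lim: "\<eta> \<longlonglongrightarrow> 0" by simp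
  have pw: "norm (p n) \<le> w n / (1 - \<kappa>)" for n
  proof -
    have "norm (p n) - norm (p (Suc n)) \<le> w n" unfolding w_def by (rule norm_triangle_ineq2)
    then show ?thesis using contr[of n] \<kappa> by (simp add: field_simps)
  qed
  have w_step: "\<bar>w (Suc n) - \<bar>k\<bar> * w n\<bar> \<le> w n * (\<delta> n / (1 - \<kappa>))" for n
  proof -
    have "(p (Suc n) - p (Suc (Suc n))) - of_real k * cnj (p n - p (Suc n))
        = cnj (p n) * (factor n - of_real k) - cnj (p (Suc n)) * (factor (Suc n) - of_real k)"
      unfolding p_Suc_factor[of "Suc n"] p_Suc_factor[of n] complex_cnj_diff
      by (simp add: algebra_simps)
    moreover have "\<bar>k\<bar> * w n = norm (of_real k * cnj (p n - p (Suc n)))"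
      unfolding w_def norm_mult complex_mod_cnj by simp
    ultimately have "\<bar>w (Suc n) - \<bar>k\<bar> * w n\<bar>
        \<le> norm (cnj (p n) * (factor n - of_real k) - cnj (p (Suc n)) * (factor (Suc n) - of_real k))"
      using norm_triangle_ineq3 unfolding w_def by metis
    also have "\<dots> \<le> norm (p n) * norm (factor n - of_real k)
        + norm (p (Suc n)) * norm (factor (Suc n) - of_real k)"
      using norm_triangle_ineq4 by (metis norm_mult complex_mod_cnj)
    also have "\<dots> \<le> norm (p n) * \<delta> n"
    proof -
      have "norm (p (Suc n)) \<le> 1 * norm (p n)"
        using contr[of n] \<kappa> mult_right_mono[of \<kappa> 1 "norm (p n)"] by simp
      then have "norm (p (Suc n)) * norm (factor (Suc n) - of_real k)
          \<le> norm (p n) * norm (factor (Suc n) - of_real k)"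
        by (intro mult_right_mono) auto
      then show ?thesis by (simp add: \<delta>_def distrib_left)
    qed
    also have "\<dots> \<le> w n / (1 - \<kappa>) * \<delta> n"
      using pw by (intro mult_right_mono) (auto simp: \<delta>_def)
    finally show ?thesis by simp
  qed
  show ?thesis
  proof (rule smallo_of_vanishing_ratio[OF _ \<eta>_lim])
    fix n
    have w0: "w n \<ge> 0" by (simp add: w_def)
    have "gap (Suc n) - \<bar>k\<bar> * gap n
        = (w (Suc n) - \<bar>k\<bar> * w n) / m (Suc n) + w n * \<bar>k\<bar> * (1 / m (Suc n) - 1 / m n)"
      unfolding gap by (simp add: algebra_simps diff_divide_distrib)
    also have "\<bar>\<dots>\<bar> \<le> \<bar>w (Suc n) - \<bar>k\<bar> * w n\<bar> / m (Suc n) + w n * \<bar>k\<bar> * \<bar>1 / m (Suc n) - 1 / m n\<bar>"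
      using abs_triangle_ineq[of "(w (Suc n) - \<bar>k\<bar> * w n) / m (Suc n)"
          "w n * \<bar>k\<bar> * (1 / m (Suc n) - 1 / m n)"] m0[of "Suc n"] w0
      by (simp add: abs_mult)
    also have "\<dots> \<le> w n * (\<delta> n / (1 - \<kappa>)) / m (Suc n) + w n * \<bar>k\<bar> * \<bar>1 / m (Suc n) - 1 / m n\<bar>"
      using w_step[of n] m0[of "Suc n"] by (intro add_mono divide_right_mono) auto
    also have "\<dots> = gap n * \<eta> n"
      using m0[of n] unfolding gap \<eta>_def by (simp add: distrib_left mult_ac)
    finally show "\<bar>gap (Suc n) - \<bar>k\<bar> * gap n\<bar> \<le> \<bar>gap n\<bar> * \<eta> n"
      by (simp add: gap_def)
  qed
qed

lemma gap_asymp_equiv: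
  assumes "k \<noteq> 0"
  shows "(\<lambda>n. gap (Suc n)) \<sim>[sequentially] (\<lambda>n. \<bar>k\<bar> * gap n)"
proof (rule smallo_imp_asymp_equiv)
  show "(\<lambda>n. gap (Suc n) - \<bar>k\<bar> * gap n) \<in> o(\<lambda>n. \<bar>k\<bar> * gap n)"
    using gap_smallo assms by simp
qed

lemma gap_le:
  "gap n \<le> 2 / (1 - norm (p 0)) * norm (p n)"
proof -
  obtain \<kappa> where \<kappa>: "0 < \<kappa>" "\<kappa> < 1" and contr: "\<And>n. norm (p (Suc n)) \<le> \<kappa> * norm (p n)"
    and mono: "\<And>n. norm (p n) \<le> norm (p 0)"
    using obtain_rate by metis
  have "norm (p (Suc n)) \<le> 1 * norm (p n)"
    using contr[of n] \<kappa> mult_right_mono[of \<kappa> 1 "norm (p n)"] by simp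
  then have num: "norm (p n - p (Suc n)) \<le> 2 * norm (p n)"
    using norm_triangle_ineq4[of "p n" "p (Suc n)"] by simp
  have "norm (cnj (p n) * p (Suc n)) \<le> norm (p 0) * 1"
    unfolding norm_mult complex_mod_cnj
    using mono[of n] less_imp_le[OF p_in_disc[of "Suc n"]] by (intro mult_mono) auto
  moreover have "1 - norm (cnj (p n) * p (Suc n)) \<le> norm (1 - cnj (p n) * p (Suc n))"
    by (metis norm_one norm_triangle_ineq2)
  ultimately have "1 - norm (p 0) \<le> norm (1 - cnj (p n) * p (Suc n))" by simp
  then have "gap n \<le> 2 * norm (p n) / (1 - norm (p 0))"
    unfolding gap_eq using num p0 by (intro frac_le) auto
  then show ?thesis by simp
qed

text \<open>For \<open>k = 0\<close> the factor of one step tends to \<open>0\<close>, so every rate is eventually reached.\<close>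

lemma p_bigo_square:
  assumes "k = 0" "q > 0"
  shows "(\<lambda>n. norm (p n)) \<in> O(\<lambda>n. q ^ n)"
proof (rule bigo_geometric_of_eventual_contraction)
  have "(\<lambda>n. norm (factor n)) \<longlonglongrightarrow> norm (complex_of_real k)"
    by (intro tendsto_norm factor_tendsto)
  then have "(\<lambda>n. norm (factor n)) \<longlonglongrightarrow> 0" using assms by simp
  then have "\<forall>\<^sub>F n in sequentially. norm (factor n) < q"
    using assms by (intro order_tendstoD(2)[where y = 0]) auto
  then show "\<forall>\<^sub>F n in sequentially. norm (p (Suc n)) \<le> q * norm (p n)"
  proof eventually_elim
    case (elim n)
    then have "norm (p n) * norm (factor n) \<le> norm (p n) * q" by (intro mult_left_mono) auto
    then show ?case unfolding p_Suc_factor norm_mult complex_mod_cnj by (simp add: mult.commute)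
  qed
qed (use assms in auto)

text \<open>For \<open>k = 0\<close> the parameter satisfies \<open>p (Suc n) = - (cnj (p n) ^ 3)\<close> exactly, and the gap is equivalent
to \<open>norm (p n)\<close>.\<close>

lemma gap_cubic:
  assumes "k = 0" "p 0 \<noteq> 0"
  shows "gap n > 0" and "(\<lambda>n. gap (n + 1)) \<sim>[sequentially] (\<lambda>n. gap n ^ 3)"
proof -
  define e where "e n = norm (p n)" for n
  have "p (Suc n) = - (cnj (p n) ^ 3)" for n
    using assms(1) by (simp add: p_Suc_factor disc_involution_def power3_eq_cube power2_eq_square)
  then have e_Suc: "e (Suc n) = e n ^ 3" for n
    by (simp add: e_def norm_power)
  have pos: "e n > 0" for n
    by (induction n) (use assms(2) e_Suc in \<open>auto simp: e_def\<close>)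
  have "e n ^ 3 < e n" for n
  proof -
    have "e n ^ 2 < 1" using p_in_disc[of n] by (simp add: e_def abs_square_less_1)
    then have "e n * e n ^ 2 < e n * 1" using pos by (intro mult_strict_left_mono) auto
    then show ?thesis by (simp add: power3_eq_cube power2_eq_square)
  qed
  then have "p n \<noteq> p (Suc n)" for n
    using e_Suc[of n] unfolding e_def by (metis order_less_irrefl)
  then show "gap n > 0" unfolding gap_eq using gap_denominator_pos by simp
  have e_lim: "(\<lambda>n. e n ^ 2) \<longlonglongrightarrow> 0"
    using tendsto_power[OF tendsto_norm[OF p_tendsto], of 2] by (simp add: e_def)
  have "(\<lambda>n. norm (p n - p (Suc n)) - e n) \<in> o(e)"
  proof (rule smallo_of_vanishing_ratio[OF _ e_lim])
    fix n
    have "\<bar>norm (p n - p (Suc n)) - e n\<bar> \<le> norm ((p n - p (Suc n)) - p n)"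
      unfolding e_def by (rule norm_triangle_ineq3)
    also have "\<dots> = e n * e n ^ 2"
      using e_Suc[of n] by (simp add: e_def power3_eq_cube power2_eq_square)
    finally show "\<bar>norm (p n - p (Suc n)) - e n\<bar> \<le> \<bar>e n\<bar> * e n ^ 2" by (simp add: e_def)
  qed
  then have "(\<lambda>n. norm (p n - p (Suc n))) \<sim>[sequentially] e"
    by (rule smallo_imp_asymp_equiv)
  moreover have "(\<lambda>n. norm (1 - cnj (p n) * p (Suc n))) \<sim>[sequentially] (\<lambda>_. 1)"
    using gap_denominator_tendsto by (intro tendsto_imp_asymp_equiv_const) auto
  ultimately have gap_e: "gap \<sim>[sequentially] e"
    using asymp_equiv_divide by (fastforce simp: gap_eq[abs_def])
  have "(\<lambda>n. gap (Suc n)) \<sim>[sequentially] (\<lambda>n. e (Suc n))"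
    by (rule asymp_equiv_compose'[OF gap_e filterlim_Suc])
  also have "(\<lambda>n. e (Suc n)) = (\<lambda>n. e n ^ 3)" using e_Suc by auto
  also have "(\<lambda>n. e n ^ 3) \<sim>[sequentially] (\<lambda>n. gap n ^ 3)"
    by (intro asymp_equiv_power asymp_equiv_symI[OF gap_e])
  finally show "(\<lambda>n. gap (n + 1)) \<sim>[sequentially] (\<lambda>n. gap n ^ 3)" by simp
qed

end

section \<open>Convergence of the quadrilaterals\<close>

definition central_rectangle :: "complex \<Rightarrow> complex \<Rightarrow> complex \<Rightarrow> quad" where
  "central_rectangle c s u = (c + s * u, c + s * cnj u, c - s * u, c - s * cnj u)"

lemma central_rectangle_opposite:
  "vertices (central_rectangle c (- s) u) = vertices (central_rectangle c s u)"
  by (auto simp: central_rectangle_def vertices_eq)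

lemma central_rectangle_props:
  assumes s: "norm s = 1" and u: "norm u = 1" "Re u \<noteq> 0" "Im u \<noteq> 0"
  shows "is_rectangle (central_rectangle c s u)"
    and "centroid (central_rectangle c s u) = c"
    and "sqlen (central_rectangle c s u) 1 3 = 4"
    and "sqlen (central_rectangle c s u) 1 2 = 4 * (Im u)\<^sup>2"
    and "sqlen (central_rectangle c s u) 1 4 = 4 - 4 * (Im u)\<^sup>2"
proof -
  have u1: "(Re u)\<^sup>2 + (Im u)\<^sup>2 = 1" using u cmod_power2[of u] by simp
  have s0: "s \<noteq> 0" using s by auto
  have orth: "orthogonal (s * x) (s * y) \<longleftrightarrow> orthogonal x y" for x y
  proof -
    have "(s * x) \<bullet> (s * y) = ((Re s)\<^sup>2 + (Im s)\<^sup>2) * (x \<bullet> y)"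
      by (simp add: inner_complex_def power2_eq_square algebra_simps)
    then show ?thesis using s cmod_power2[of s] by (simp add: orthogonal_def)
  qed
  have "distinct [c + s * u, c + s * cnj u, c - s * u, c - s * cnj u]"
  proof -
    have "distinct [u, cnj u, - u, - cnj u]"
      using u by (auto simp: complex_eq_iff)
    moreover have "inj (\<lambda>x. c + s * x)" using s0 by (simp add: inj_def)
    ultimately have "distinct (map (\<lambda>x. c + s * x) [u, cnj u, - u, - cnj u])"
      by (simp only: distinct_map) (metis inj_on_subset subset_UNIV)
    then show ?thesis by (simp only: list.map mult_minus_right add_uminus_conv_diff)
  qed
  moreover have "(c - s * cnj u) - (c + s * u) = s * (- cnj u - u)" "(c + s * cnj u) - (c + s * u) = s * (cnj u - u)"
    "(c + s * u) - (c + s * cnj u) = s * (u - cnj u)" "(c - s * u) - (c + s * cnj u) = s * (- u - cnj u)"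
    "(c + s * cnj u) - (c - s * u) = s * (cnj u + u)" "(c - s * cnj u) - (c - s * u) = s * (u - cnj u)"
    "(c - s * u) - (c - s * cnj u) = s * (cnj u - u)" "(c + s * u) - (c - s * cnj u) = s * (u + cnj u)"
    by (simp_all add: algebra_simps)
  ultimately show "is_rectangle (central_rectangle c s u)"
    unfolding central_rectangle_def is_rectangle.simps
    by (simp only: orth) (simp add: orthogonal_def inner_complex_def)
  show "centroid (central_rectangle c s u) = c"
    by (simp add: central_rectangle_def centroid_eq)
  have len: "(dist (s * x) (s * y))\<^sup>2 = (Re x - Re y)\<^sup>2 + (Im x - Im y)\<^sup>2" for x y
  proof -
    have "dist (s * x) (s * y) = norm (s * (x - y))"
      by (simp add: dist_norm right_diff_distrib)
    also have "\<dots> = norm (x - y)" using s by (simp add: norm_mult)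
    finally show ?thesis by (simp add: cmod_power2)
  qed
  have len': "(dist (c + s * x) (c - s * y))\<^sup>2 = (Re x + Re y)\<^sup>2 + (Im x + Im y)\<^sup>2" for x y
  proof -
    have "dist (c + s * x) (c - s * y) = dist (s * x) (s * - y)" by (simp add: dist_norm)
    then show ?thesis using len[of x "- y"] by simp
  qed
  have coords: "sqlen (central_rectangle c s u) 1 3 = (Re u + Re u)\<^sup>2 + (Im u + Im u)\<^sup>2"
    "sqlen (central_rectangle c s u) 1 2 = (Re u - Re u)\<^sup>2 + (Im u - (- Im u))\<^sup>2"
    "sqlen (central_rectangle c s u) 1 4 = (Re u + Re u)\<^sup>2 + (Im u + (- Im u))\<^sup>2"
    unfolding sqlen_def central_rectangle_def by (simp_all add: len len')
  show "sqlen (central_rectangle c s u) 1 3 = 4" "sqlen (central_rectangle c s u) 1 2 = 4 * (Im u)\<^sup>2"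
    "sqlen (central_rectangle c s u) 1 4 = 4 - 4 * (Im u)\<^sup>2"
    using u1 unfolding coords by (simp_all add: power2_eq_square)
qed

text \<open>For a small parameter the involution is close to the half turn \<open>z \<mapsto> - z\<close>.\<close>

lemma norm_disc_involution_add_le:
  assumes p: "norm p \<le> r" "r < 1" and z: "norm z = 1"
  shows "norm (disc_involution p z + z) \<le> 2 / (1 - r) * norm p"
proof -
  have nz: "1 - cnj p * z \<noteq> 0" using disc_involution_denominator_nonzero[of p z] p z by simp
  have "norm (cnj p * z) \<le> r" using p z by (simp add: norm_mult)
  moreover have "1 - norm (cnj p * z) \<le> norm (1 - cnj p * z)" by (metis norm_one norm_triangle_ineq2)
  ultimately have d: "1 - r \<le> norm (1 - cnj p * z)" by simp
  have "disc_involution p z + z = (p - cnj p * z\<^sup>2) / (1 - cnj p * z)"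
    using nz by (simp add: disc_involution_def field_simps power2_eq_square)
  then have "norm (disc_involution p z + z) = norm (p - cnj p * z\<^sup>2) / norm (1 - cnj p * z)"
    by (simp add: norm_divide)
  moreover have "norm (p - cnj p * z\<^sup>2) \<le> 2 * norm p"
    using norm_triangle_ineq4[of p "cnj p * z\<^sup>2"] z by (simp add: norm_mult norm_power)
  ultimately have "norm (disc_involution p z + z) \<le> 2 * norm p / (1 - r)"
    using d p(2) by (simp only:) (rule frac_le, auto)
  then show ?thesis by simp
qed

lemma dist_quad_le:
  fixes A B C D A' B' C' D' :: complex
  assumes "dist A A' \<le> e" "dist B B' \<le> e" "dist C C' \<le> e" "dist D D' \<le> e"
  shows "dist (A, B, C, D) (A', B', C', D') \<le> 4 * e"
proof -
  have pair: "dist (x, y) (x', y') \<le> dist x x' + dist y y'" for x x' :: "'b::metric_space" and y y' :: "'c::metric_space"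
    unfolding dist_Pair_Pair by (rule sqrt_sum_squares_le_sum) auto
  show ?thesis
    using assms pair[of A "(B, C, D)" A' "(B', C', D')"] pair[of B "(C, D)" B' "(C', D')"] pair[of C D C' D']
    by linarith
qed

text \<open>Each step reverses the rotation up to an error of the order of the parameter.\<close>

lemma rotation_increment:
  assumes k: "\<bar>k\<bar> < 1" and p: "norm p \<le> r" "r < 1" and \<rho>: "norm \<rho> = 1"
    and p': "norm (next_parameter k p) \<le> 1"
  shows "norm (next_rotation k \<rho> p + \<rho>) \<le> 2 / (1 - r) * norm p"
proof -
  define p' where "p' = next_parameter k p"
  let ?d = "1 - cnj p * p'"
  have "norm (cnj p * p') \<le> r * 1"
    unfolding norm_mult complex_mod_cnj using p p' order_trans[OF norm_ge_zero p(1)]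
    by (intro mult_mono) (auto simp: p'_def)
  moreover have "1 - norm (cnj p * p') \<le> norm ?d" by (metis norm_one norm_triangle_ineq2)
  ultimately have d: "1 - r \<le> norm ?d" by simp
  then have nz: "?d \<noteq> 0" using p by auto
  have "next_rotation k \<rho> p + \<rho> = \<rho> * ((p * cnj p' - cnj p * p') / ?d)"
    using nz by (simp add: next_rotation_def p'_def[symmetric] divide_simps) (simp add: algebra_simps)
  then have "norm (next_rotation k \<rho> p + \<rho>) = norm (p * cnj p' - cnj p * p') / norm ?d"
    using \<rho> by (simp add: norm_mult norm_divide)
  also have "\<dots> \<le> 2 * norm p / (1 - r)"
  proof (rule frac_le)
    have "norm (p * cnj p' - cnj p * p') \<le> norm p * norm p' + norm p * norm p'"
      using norm_triangle_ineq4 by (metis norm_mult complex_mod_cnj)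
    also have "norm p * norm p' \<le> norm p * 1" using p' by (intro mult_left_mono) (auto simp: p'_def)
    finally show "norm (p * cnj p' - cnj p * p') \<le> 2 * norm p" by simp
  qed (use d p in auto)
  finally show ?thesis by simp
qed

locale quad_orbit = parameter_orbit "Re (u\<^sup>2)" p for u :: complex and p :: "nat \<Rightarrow> complex" +
  fixes c :: complex and \<rho> :: "nat \<Rightarrow> complex" and T :: "nat \<Rightarrow> quad"
  assumes u: "norm u = 1" "Re u \<noteq> 0" "Im u \<noteq> 0"
    and rotation: "\<And>n. norm (\<rho> n) = 1"
    and rotation_Suc: "\<And>n. \<rho> (Suc n) = next_rotation (Re (u\<^sup>2)) (\<rho> n) (p n)"
    and T: "\<And>n. T n = moebius_rectangle c (\<rho> n) (p n) u"
begin

text \<open>The rotations with alternating sign have summable increments, hence a limit. The involution itself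
contributes another half turn, so \<open>s\<close> is the negative of this limit.\<close>

lemma limit_rectangles:
  obtains s M where "norm s = 1"
    "\<And>n. dist (T n) (central_rectangle c ((- 1) ^ n * s) u) \<le> M * norm (p n)"
proof -
  define r where "r = norm (p 0)"
  have r: "r < 1" using p0 by (simp add: r_def)
  obtain \<kappa> where \<kappa>: "0 < \<kappa>" "\<kappa> < 1" and contr: "\<And>n. norm (p (Suc n)) \<le> \<kappa> * norm (p n)"
    and mono: "\<And>n. norm (p n) \<le> r"
    using obtain_rate unfolding r_def by metis
  define \<sigma> where "\<sigma> n = (- 1) ^ n * \<rho> n" for n
  have \<sigma>1: "norm (\<sigma> n) = 1" for n by (simp add: \<sigma>_def norm_mult norm_power rotation)
  have "dist (\<sigma> (Suc n)) (\<sigma> n) \<le> 2 / (1 - r) * norm (p n)" for n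
  proof -
    have "\<sigma> (Suc n) - \<sigma> n = - ((- 1) ^ n * (\<rho> (Suc n) + \<rho> n))"
      by (simp add: \<sigma>_def algebra_simps)
    then have "dist (\<sigma> (Suc n)) (\<sigma> n) = norm (\<rho> (Suc n) + \<rho> n)"
      by (simp add: dist_norm norm_mult norm_power)
    then show ?thesis
      unfolding rotation_Suc using rotation_increment[OF k mono r rotation, of n n]
        p_in_disc[of "Suc n"] by (simp add: p_Suc)
  qed
  then obtain s where s: "\<And>n. dist (\<sigma> n) s \<le> 2 / (1 - r) / (1 - \<kappa>) * norm (p n)" "\<sigma> \<longlonglongrightarrow> s"
    using convergent_of_contracting_increments[of \<kappa> "\<lambda>n. norm (p n)" \<sigma> "2 / (1 - r)"] \<kappa> contr r
    by (metis divide_nonneg_pos diff_gt_0_iff_gt less_imp_le norm_ge_zero zero_le_numeral)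
  have "(\<lambda>n. norm (\<sigma> n)) \<longlonglongrightarrow> norm s" using s(2) by (rule tendsto_norm)
  then have s1: "norm s = 1" by (simp add: \<sigma>1 LIMSEQ_const_iff)
  define K where "K = 2 / (1 - r) / (1 - \<kappa>) + 2 / (1 - r)"
  have vertex: "dist (c + \<rho> n * disc_involution (p n) z) (c - (- 1) ^ n * s * z) \<le> K * norm (p n)"
    if z: "norm z = 1" for n z
  proof -
    have "\<rho> n = (- 1) ^ n * \<sigma> n"
      by (simp add: \<sigma>_def mult.assoc[symmetric] power_mult_distrib[symmetric])
    then have "c + \<rho> n * disc_involution (p n) z - (c - (- 1) ^ n * s * z)
        = (- 1) ^ n * (\<sigma> n * (disc_involution (p n) z + z) - (\<sigma> n - s) * z)"
      by (simp add: algebra_simps)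
    then have "dist (c + \<rho> n * disc_involution (p n) z) (c - (- 1) ^ n * s * z)
        = norm (\<sigma> n * (disc_involution (p n) z + z) - (\<sigma> n - s) * z)"
      by (simp add: dist_norm norm_mult norm_power)
    also have "\<dots> \<le> norm (disc_involution (p n) z + z) + dist (\<sigma> n) s"
      using norm_triangle_ineq4[of "\<sigma> n * (disc_involution (p n) z + z)" "(\<sigma> n - s) * z"] \<sigma>1 z
      by (simp add: norm_mult dist_norm)
    also have "\<dots> \<le> K * norm (p n)"
      using norm_disc_involution_add_le[OF mono r z, of n] s(1)[of n]
      by (simp add: K_def distrib_right)
    finally show ?thesis .
  qed
  have "dist (T n) (central_rectangle c ((- 1) ^ n * - s) u) \<le> 4 * K * norm (p n)" for n
  proof -
    have "dist (T n) (central_rectangle c ((- 1) ^ n * - s) u) \<le> 4 * (K * norm (p n))"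
      unfolding T moebius_rectangle_def central_rectangle_def
      using vertex[of u n] vertex[of "cnj u" n] vertex[of "- u" n] vertex[of "- cnj u" n] u
      by (intro dist_quad_le) simp_all
    then show ?thesis by simp
  qed
  moreover have "norm (- s) = 1" using s1 by simp
  ultimately show thesis using that by blast
qed

lemma convex_cyclic: "convex_cyclic_quad c (T n)"
  unfolding T using moebius_rectangle_convex_cyclic rotation p_in_disc u by blast

lemma centroid_eq_gap: "dist (centroid (T n)) c = gap n"
  unfolding T centroid_moebius_rectangle[OF rotation p_in_disc u] gap_def p_Suc
  by (simp add: dist_norm norm_mult rotation)

text \<open>The rate \<open>q\<close> stays a variable in the first conclusion: one rate is available in general, and
every rate in the square case.\<close>

lemma limits:
  obtains L L' where
    "\<And>q. \<lbrakk>0 < q; q < 1; (\<lambda>n. norm (p n)) \<in> O(\<lambda>n. q ^ n)\<rbrakk> \<Longrightarrow>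
      (\<lambda>i. dist (T (2 * i)) L) \<in> O(\<lambda>i. q ^ i) \<and> (\<lambda>i. dist (T (2 * i + 1)) L') \<in> O(\<lambda>i. q ^ i)"
    "(\<lambda>i. T (2 * i)) \<longlonglongrightarrow> L" "(\<lambda>i. T (2 * i + 1)) \<longlonglongrightarrow> L'"
    "vertices L = vertices L'"
    "\<And>R. R \<in> {L, L'} \<Longrightarrow> is_rectangle R \<and> centroid R = c \<and> sqlen R 1 3 = 4
      \<and> sqlen R 1 2 = 4 * (Im u)\<^sup>2 \<and> sqlen R 1 4 = 4 - 4 * (Im u)\<^sup>2"
proof -
  obtain s M where s: "norm s = 1"
    and M: "\<And>n. dist (T n) (central_rectangle c ((- 1) ^ n * s) u) \<le> M * norm (p n)"
    using limit_rectangles by metis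
  define L where "L = central_rectangle c s u"
  define L' where "L' = central_rectangle c (- s) u"
  have even: "dist (T (2 * i)) L \<le> M * norm (p (2 * i))" for i
    using M[of "2 * i"] by (simp add: L_def)
  have odd: "dist (T (2 * i + 1)) L' \<le> M * norm (p (2 * i + 1))" for i
    using M[of "2 * i + 1"] by (simp add: L'_def)
  have lim: "(\<lambda>i. X (h i)) \<longlonglongrightarrow> Y"
    if "\<And>i. dist (X (h i)) Y \<le> M * norm (p (h i))" and h: "\<And>i. i \<le> h i" for X :: "nat \<Rightarrow> quad" and h Y
  proof -
    have "filterlim h at_top sequentially"
      using h by (intro filterlim_at_top_mono[OF filterlim_ident]) auto
    then have "(\<lambda>i. p (h i)) \<longlonglongrightarrow> 0" using p_tendsto filterlim_compose by blast
    then have "(\<lambda>i. M * norm (p (h i))) \<longlonglongrightarrow> M * norm (0::complex)" by (intro tendsto_intros)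
    then have "(\<lambda>i. M * norm (p (h i))) \<longlonglongrightarrow> 0" by simp
    then have "(\<lambda>i. dist (X (h i)) Y) \<longlonglongrightarrow> 0"
      by (rule Lim_null_comparison[rotated]) (simp add: that(1))
    then show ?thesis by (rule tendsto_dist_iff[THEN iffD2])
  qed
  have bigo: "(\<lambda>i. dist (X (h i)) Y) \<in> O(\<lambda>i. q ^ i)"
    if "\<And>i. dist (X (h i)) Y \<le> M * norm (p (h i))" and h: "\<And>i. i \<le> h i"
      and q: "0 < q" "q < 1" "(\<lambda>n. norm (p n)) \<in> O(\<lambda>n. q ^ n)" for X :: "nat \<Rightarrow> quad" and h Y q
  proof -
    have "(\<lambda>i. dist (X (h i)) Y) \<in> O(\<lambda>i. norm (p (h i)))"
      using that(1) by (intro bigoI[of _ M]) auto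
    also have "(\<lambda>i. norm (p (h i))) \<in> O(\<lambda>i. q ^ i)"
      using bigo_geometric_reindex[OF q(3,1,2) h] .
    finally show ?thesis .
  qed
  have rect: "is_rectangle R \<and> centroid R = c \<and> sqlen R 1 3 = 4
      \<and> sqlen R 1 2 = 4 * (Im u)\<^sup>2 \<and> sqlen R 1 4 = 4 - 4 * (Im u)\<^sup>2" if "R \<in> {L, L'}" for R
    using that central_rectangle_props[OF s u] central_rectangle_props[of "- s", OF _ u] s
    unfolding L_def L'_def by auto
  show thesis
  proof (rule that)
    show "(\<lambda>i. T (2 * i)) \<longlonglongrightarrow> L" by (rule lim[where h = "\<lambda>i. 2 * i", OF even]) simp
    show "(\<lambda>i. T (2 * i + 1)) \<longlonglongrightarrow> L'" by (rule lim[where h = "\<lambda>i. 2 * i + 1", OF odd]) simp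
    show "vertices L = vertices L'" unfolding L_def L'_def central_rectangle_opposite ..
    show "(\<lambda>i. dist (T (2 * i)) L) \<in> O(\<lambda>i. q ^ i) \<and> (\<lambda>i. dist (T (2 * i + 1)) L') \<in> O(\<lambda>i. q ^ i)"
      if "0 < q" "q < 1" "(\<lambda>n. norm (p n)) \<in> O(\<lambda>n. q ^ n)" for q
      using bigo[where h = "\<lambda>i. 2 * i", OF even _ that] bigo[where h = "\<lambda>i. 2 * i + 1", OF odd _ that]
      by simp
  qed (rule rect)
qed

end

lemma quad_seq_orbit:
  assumes \<rho>: "norm \<rho>0 = 1" and p: "norm p0 < 1" and u: "norm u = 1" "Re u \<noteq> 0" "Im u \<noteq> 0"
  obtains \<rho> p where "quad_orbit u p c \<rho> (quad_seq c (moebius_rectangle c \<rho>0 p0 u))"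
    "\<rho> 0 = \<rho>0" "p 0 = p0"
proof -
  define k where "k = Re (u\<^sup>2)"
  have k: "\<bar>k\<bar> < 1" unfolding k_def by (rule abs_Re_square_less_1[OF u])
  define p where "p n = (next_parameter k ^^ n) p0" for n
  define \<rho> where "\<rho> = rec_nat \<rho>0 (\<lambda>n \<rho>. next_rotation k \<rho> (p n))"
  have p_Suc: "p (Suc n) = next_parameter k (p n)" for n by (simp add: p_def)
  have \<rho>_Suc: "\<rho> (Suc n) = next_rotation k (\<rho> n) (p n)" for n by (simp add: \<rho>_def)
  have p1: "norm (p n) < 1" for n
    by (induction n) (use next_parameter_disc[OF k] p p_Suc in \<open>auto simp: p_def\<close>)
  have \<rho>1: "norm (\<rho> n) = 1" for n
  proof (induction n)
    case 0 show ?case using \<rho> by (simp add: \<rho>_def)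
  next
    case (Suc n) show ?case unfolding \<rho>_Suc by (rule norm_next_rotation[OF k p1 Suc])
  qed
  have "quad_seq c (moebius_rectangle c \<rho>0 p0 u) n = moebius_rectangle c (\<rho> n) (p n) u" for n
  proof (induction n)
    case 0 show ?case by (simp add: quad_seq_def \<rho>_def p_def)
  next
    case (Suc n)
    have "quad_seq c (moebius_rectangle c \<rho>0 p0 u) (Suc n) = next_quad c (moebius_rectangle c (\<rho> n) (p n) u)"
      using Suc by (simp add: quad_seq_def)
    then show ?case
      using next_quad_moebius_rectangle(2)[OF \<rho>1 p1 u] by (simp add: p_Suc \<rho>_Suc k_def)
  qed
  then have "quad_orbit u p c \<rho> (quad_seq c (moebius_rectangle c \<rho>0 p0 u))"
    using k p1[of 0] p_Suc u \<rho>1 \<rho>_Suc by unfold_locales (auto simp: k_def)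
  then show thesis using that[of p \<rho>] by (simp add: \<rho>_def p_def)
qed

theorem theorem4:
  fixes c :: complex
  shows
    "(\<forall>T0. convex_cyclic_quad c T0 \<longrightarrow>
        (\<forall>n. convex_cyclic_quad c (quad_seq c T0 n) \<and>
             next_quad_well_defined c (quad_seq c T0 n)) \<and>
        (\<exists>L L'.
           (\<lambda>i. quad_seq c T0 (2 * i)) \<longlonglongrightarrow> L \<and>
           (\<lambda>i. quad_seq c T0 (2 * i + 1)) \<longlonglongrightarrow> L' \<and>
           vertices L = vertices L' \<and>
           (\<forall>R\<in>{L, L'}.
              is_rectangle R \<and>
              centroid R = c \<and>
              sqlen R 1 3 = 4 \<and>
              sqlen R 1 2 = 4 * (sqrt (sqlen T0 1 2 * sqlen T0 3 4)
                                 / sqrt (sqlen T0 1 3 * sqlen T0 2 4)) \<and>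
              sqlen R 1 4 = 4 - sqlen R 1 2) \<and>
           (\<not> is_square L \<longrightarrow>
              ((\<forall>n. OG c T0 n > 0) \<longrightarrow>
                 (\<lambda>n. OG c T0 (n + 1)) \<sim>[sequentially]
                 (\<lambda>n. \<bar>sqlen L 1 2 - 2\<bar> / 2 * OG c T0 n)) \<and>
              at_least_geometric (\<lambda>i. quad_seq c T0 (2 * i)) L \<and>
              at_least_geometric (\<lambda>i. quad_seq c T0 (2 * i + 1)) L' \<and>
              at_least_geometric (\<lambda>n. centroid (quad_seq c T0 n)) c) \<and>
           (is_square L \<longrightarrow>
              (\<lambda>n. OG c T0 (n + 1)) \<in> o(\<lambda>n. OG c T0 n) \<and>
              faster_than_geometric (\<lambda>i. quad_seq c T0 (2 * i)) L \<and>
              faster_than_geometric (\<lambda>i. quad_seq c T0 (2 * i + 1)) L' \<and>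
              faster_than_geometric (\<lambda>n. centroid (quad_seq c T0 n)) c)))
     \<and>
     (\<exists>T0 L L'.
        convex_cyclic_quad c T0 \<and>
        (\<lambda>i. quad_seq c T0 (2 * i)) \<longlonglongrightarrow> L \<and>
        (\<lambda>i. quad_seq c T0 (2 * i + 1)) \<longlonglongrightarrow> L' \<and>
        is_square L \<and> is_square L' \<and>
        (\<forall>n. OG c T0 n > 0) \<and>
        (\<lambda>n. OG c T0 (n + 1)) \<sim>[sequentially] (\<lambda>n. OG c T0 n ^ 3))"
proof (intro conjI allI impI)
  fix T0 assume "convex_cyclic_quad c T0"
  then obtain \<rho>0 p0 u where T0: "norm \<rho>0 = 1" "norm p0 < 1" "norm u = 1" "Re u \<noteq> 0" "Im u \<noteq> 0"
    "T0 = moebius_rectangle c \<rho>0 p0 u"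
    by (rule convex_cyclic_quad_moebius_rectangle)
  from quad_seq_orbit[OF T0(1-5), of c] obtain \<rho> p where "quad_orbit u p c \<rho> (quad_seq c T0)"
    unfolding T0(6) by metis
  then interpret quad_orbit u p c \<rho> "quad_seq c T0" .
  define k where "k = Re (u\<^sup>2)"
  show "convex_cyclic_quad c (quad_seq c T0 n)" for n by (rule convex_cyclic)
  show "next_quad_well_defined c (quad_seq c T0 n)" for n
    unfolding T by (rule next_quad_moebius_rectangle(1)[OF rotation p_in_disc u])
  have OG: "OG c T0 n = gap n" for n
    using centroid_eq_gap[of n] by (simp add: OG_def dist_commute)
  have k_Im: "k = 1 - 2 * (Im u)\<^sup>2"
    using u(1) cmod_power2[of u] by (simp add: k_def power2_eq_square)
  have gap_bigo: "gap \<in> O(\<lambda>n. norm (p n))"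
    using gap_le by (intro bigoI[of _ "2 / (1 - norm (p 0))"]) (simp add: gap_def)
  have centroid_bigo: "(\<lambda>n. dist (centroid (quad_seq c T0 n)) c) \<in> O(\<lambda>n. q ^ n)"
    if "(\<lambda>n. norm (p n)) \<in> O(\<lambda>n. q ^ n)" for q
    unfolding centroid_eq_gap using landau_o.big_trans[OF gap_bigo that] by simp
  obtain L L' where bigo: "\<And>q. \<lbrakk>0 < q; q < 1; (\<lambda>n. norm (p n)) \<in> O(\<lambda>n. q ^ n)\<rbrakk> \<Longrightarrow>
      (\<lambda>i. dist (quad_seq c T0 (2 * i)) L) \<in> O(\<lambda>i. q ^ i)
      \<and> (\<lambda>i. dist (quad_seq c T0 (2 * i + 1)) L') \<in> O(\<lambda>i. q ^ i)"
    and lim: "(\<lambda>i. quad_seq c T0 (2 * i)) \<longlonglongrightarrow> L" "(\<lambda>i. quad_seq c T0 (2 * i + 1)) \<longlonglongrightarrow> L'"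
    "vertices L = vertices L'"
    and rect: "\<And>R. R \<in> {L, L'} \<Longrightarrow> is_rectangle R \<and> centroid R = c \<and> sqlen R 1 3 = 4
      \<and> sqlen R 1 2 = 4 * (Im u)\<^sup>2 \<and> sqlen R 1 4 = 4 - 4 * (Im u)\<^sup>2"
    using limits by blast
  have square: "is_square L \<longleftrightarrow> k = 0"
    using rect[of L] by (auto simp: is_square_def k_Im)
  have ratio: "\<bar>sqlen L 1 2 - 2\<bar> / 2 = \<bar>k\<bar>"
    using rect[of L] by (simp add: k_Im abs_if)
  have Im_eq: "(Im u)\<^sup>2 = sqrt (sqlen T0 1 2 * sqlen T0 3 4) / sqrt (sqlen T0 1 3 * sqlen T0 2 4)"
    unfolding T0(6) by (rule sqlen_ratio_moebius_rectangle[OF T0(1-3), symmetric])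
  obtain q where q: "0 < q" "q < 1" "(\<lambda>n. norm (p n)) \<in> O(\<lambda>n. q ^ n)" by (rule p_bigo)
  have slow: "(\<lambda>n. OG c T0 (n + 1)) \<sim>[sequentially] (\<lambda>n. \<bar>sqlen L 1 2 - 2\<bar> / 2 * OG c T0 n)"
    "at_least_geometric (\<lambda>i. quad_seq c T0 (2 * i)) L"
    "at_least_geometric (\<lambda>i. quad_seq c T0 (2 * i + 1)) L'"
    "at_least_geometric (\<lambda>n. centroid (quad_seq c T0 n)) c" if "\<not> is_square L"
    using gap_asymp_equiv that q bigo[OF q] centroid_bigo[OF q(3)]
    unfolding ratio OG at_least_geometric_def square k_def by auto
  have fast: "(\<lambda>n. OG c T0 (n + 1)) \<in> o(\<lambda>n. OG c T0 n)"
    "faster_than_geometric (\<lambda>i. quad_seq c T0 (2 * i)) L"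
    "faster_than_geometric (\<lambda>i. quad_seq c T0 (2 * i + 1)) L'"
    "faster_than_geometric (\<lambda>n. centroid (quad_seq c T0 n)) c" if "is_square L"
  proof -
    have k0: "Re (u\<^sup>2) = 0" using that by (simp only: square k_def)
    show "(\<lambda>n. OG c T0 (n + 1)) \<in> o(\<lambda>n. OG c T0 n)"
      using gap_smallo unfolding k0 OG by simp
    show "faster_than_geometric (\<lambda>i. quad_seq c T0 (2 * i)) L"
      "faster_than_geometric (\<lambda>i. quad_seq c T0 (2 * i + 1)) L'"
      "faster_than_geometric (\<lambda>n. centroid (quad_seq c T0 n)) c"
      using bigo p_bigo_square[OF k0] centroid_bigo
      unfolding faster_than_geometric_def by auto
  qed
  show "\<exists>L L'.
           (\<lambda>i. quad_seq c T0 (2 * i)) \<longlonglongrightarrow> L \<and>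
           (\<lambda>i. quad_seq c T0 (2 * i + 1)) \<longlonglongrightarrow> L' \<and>
           vertices L = vertices L' \<and>
           (\<forall>R\<in>{L, L'}.
              is_rectangle R \<and>
              centroid R = c \<and>
              sqlen R 1 3 = 4 \<and>
              sqlen R 1 2 = 4 * (sqrt (sqlen T0 1 2 * sqlen T0 3 4)
                                 / sqrt (sqlen T0 1 3 * sqlen T0 2 4)) \<and>
              sqlen R 1 4 = 4 - sqlen R 1 2) \<and>
           (\<not> is_square L \<longrightarrow>
              ((\<forall>n. OG c T0 n > 0) \<longrightarrow>
                 (\<lambda>n. OG c T0 (n + 1)) \<sim>[sequentially]
                 (\<lambda>n. \<bar>sqlen L 1 2 - 2\<bar> / 2 * OG c T0 n)) \<and>
              at_least_geometric (\<lambda>i. quad_seq c T0 (2 * i)) L \<and>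
              at_least_geometric (\<lambda>i. quad_seq c T0 (2 * i + 1)) L' \<and>
              at_least_geometric (\<lambda>n. centroid (quad_seq c T0 n)) c) \<and>
           (is_square L \<longrightarrow>
              (\<lambda>n. OG c T0 (n + 1)) \<in> o(\<lambda>n. OG c T0 n) \<and>
              faster_than_geometric (\<lambda>i. quad_seq c T0 (2 * i)) L \<and>
              faster_than_geometric (\<lambda>i. quad_seq c T0 (2 * i + 1)) L' \<and>
              faster_than_geometric (\<lambda>n. centroid (quad_seq c T0 n)) c)"
    by (intro exI[of _ L] exI[of _ L'] conjI ballI impI)
      (use lim rect slow fast in \<open>simp_all add: Im_eq\<close>)
next
  \<comment> \<open>The square has \<open>u\<^sup>2 = \<i>\<close>; any nonzero parameter in the disc gives convergence of order three.\<close>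
  define u where "u = cis (pi / 4)"
  define T0 where "T0 = moebius_rectangle c 1 (1 / 2) u"
  have u: "norm u = 1" "Re u \<noteq> 0" "Im u \<noteq> 0"
    by (simp_all add: u_def cos_45 sin_45)
  have k0: "Re (u\<^sup>2) = 0"
    by (simp add: u_def power2_eq_square cos_45 sin_45)
  have "norm (1 :: complex) = 1" "norm (1 / 2 :: complex) < 1" by simp_all
  from quad_seq_orbit[OF this u, of c] obtain \<rho> p
    where orbit: "quad_orbit u p c \<rho> (quad_seq c T0)" and start: "p 0 = 1 / 2"
    unfolding T0_def by metis
  interpret quad_orbit u p c \<rho> "quad_seq c T0" by (rule orbit)
  have OG: "OG c T0 n = gap n" for n
    using centroid_eq_gap[of n] by (simp add: OG_def dist_commute)
  obtain L L' where
    lim: "(\<lambda>i. quad_seq c T0 (2 * i)) \<longlonglongrightarrow> L" "(\<lambda>i. quad_seq c T0 (2 * i + 1)) \<longlonglongrightarrow> L'"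
    and rect: "\<And>R. R \<in> {L, L'} \<Longrightarrow> is_rectangle R \<and> centroid R = c \<and> sqlen R 1 3 = 4
      \<and> sqlen R 1 2 = 4 * (Im u)\<^sup>2 \<and> sqlen R 1 4 = 4 - 4 * (Im u)\<^sup>2"
    by (rule limits) (rule that, assumption, assumption, blast)
  have "(Im u)\<^sup>2 = 1 / 2" by (simp add: u_def sin_45 power_divide)
  then have squares: "is_square L" "is_square L'" using rect by (auto simp: is_square_def)
  have "convex_cyclic_quad c T0"
    using convex_cyclic[of 0] by (simp add: quad_seq_def)
  moreover have "OG c T0 n > 0" for n
    unfolding OG by (rule gap_cubic(1)[OF k0]) (simp add: start)
  moreover have "(\<lambda>n. OG c T0 (n + 1)) \<sim>[sequentially] (\<lambda>n. OG c T0 n ^ 3)"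
    unfolding OG by (rule gap_cubic(2)[OF k0]) (simp add: start)
  ultimately show "\<exists>T0 L L'.
        convex_cyclic_quad c T0 \<and>
        (\<lambda>i. quad_seq c T0 (2 * i)) \<longlonglongrightarrow> L \<and>
        (\<lambda>i. quad_seq c T0 (2 * i + 1)) \<longlonglongrightarrow> L' \<and>
        is_square L \<and> is_square L' \<and>
        (\<forall>n. OG c T0 n > 0) \<and>
        (\<lambda>n. OG c T0 (n + 1)) \<sim>[sequentially] (\<lambda>n. OG c T0 n ^ 3)"
    using lim squares by (intro exI[of _ T0] exI[of _ L] exI[of _ L'] conjI allI)
qed

end
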